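(* Let $\varepsilon\in(0,1]$, $\gamma\ge1$, $\eta>0$, $\delta t>0$, and let $\mathcal T=(\mathcal M,\mathcal E)$ be a MAC grid of $\Omega$. Let $(\rho^n,\boldsymbol u^n),(\rho^{n+1},\boldsymbol u^{n+1})\in L_{\mathcal M}(\Omega)\times\boldsymbol H_{\mathcal E,0}(\Omega)$, with $\rho^n,\rho^{n+1}>0$, satisfy the semi-implicit scheme $$\frac{1}{\delta t}(\rho_K^{n+1}-\rho_K^n)+\frac{1}{|K|}\sum_{\sigma\in\mathcal E(K)}F_{\sigma,K}(\rho^{n+1},\boldsymbol v^n)=0,\quad\forall K\in\mathcal M,$$ $$\frac{1}{\delta t}(\rho_{D_\sigma}^{n+1}u_\sigma^{n+1}-\rho_{D_\sigma}^nu_\sigma^n)+\frac{1}{|D_\sigma|}\sum_{\epsilon\in\tilde{\mathcal E}(D_\sigma)}F_{\epsilon,\sigma}(\rho^{n+1},\boldsymbol v^n)u^n_{\epsilon,\mathrm{up}}+\frac{1}{\varepsilon^2}(\partial^{(i)}_{\mathcal E}p^{n+1})_\sigma=0,\quad \forall\, 1\le i\le d,\ \forall\sigma\in\mathcal E^{(i)}_{\mathrm{int}}.$$ Assume that for all $1\le i\le d$ and all $\sigma\in\mathcal E^{(i)}_{\mathrm{int}}$: (i) $\displaystyle \eta\ge\frac{1}{\rho^{n+1}_{D_\sigma}}$; (ii) $\displaystyle \frac{\delta t}{|D_\sigma|}\sum_{\epsilon\in\tilde{\mathcal E}(D_\sigma)}\frac{-\big(F_{\epsilon,\sigma}(\rho^{n+1},\boldsymbol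 v^n)\big)^-}{\rho^{n+1}_{D_\sigma}}\le\frac12$. Then $$\frac{1}{\varepsilon^2}\sum_{K\in\mathcal M}|K|\Pi_\gamma(\rho_K^{n+1})+\sum_{\sigma\in\mathcal E_{\mathrm{int}}}|D_\sigma|\frac12\rho_{D_\sigma}^{n+1}(u_\sigma^{n+1})^2\le\frac{1}{\varepsilon^2}\sum_{K\in\mathcal M}|K|\Pi_\gamma(\rho_K^{n})+\sum_{\sigma\in\mathcal E_{\mathrm{int}}}|D_\sigma|\frac12\rho_{D_\sigma}^{n}(u_\sigma^{n})^2 .$$
   Context: Mesh. $\Omega\subset\mathbb R^d$ is open, bounded, connected, and its closure is a finite union of closed axis-parallel rectangles ($d=2$) or parallelepipeds ($d=3$). A MAC grid is a pair $\mathcal T=(\mathcal M,\mathcal E)$: $\mathcal M$ (primal mesh) is a structured, possibly non-uniform, partition of $\bar\Omega$ into closed axis-parallel rectangles/parallelepipeds $K$; $\mathcal E$ is the set of all ($(d-1)$-dimensional) edges of the cells; $\mathcal E(K)$ is the set of edges of $K$. $\mathcal E^{(i)}=\mathcal E^{(i)}_{\mathrm{int}}\cup\mathcal E^{(i)}_{\mathrm{ext}}$ are the (internal/external) edges orthogonal to the canonical basis vector $\boldsymbol e^{(i)}$; $\mathcal E_{\mathrm{int}}=\cup_i\mathcal E^{(i)}_{\mathrm{int}}$. $\sigma=K|L$ denotes the internal edge common to $K$ and $L$. $|\cdot|$ denotes Lebesgue measure of the appropriate dimension. $\boldsymbol\nu_{\sigma,K}$ is the unit normal to $\sigma$ outward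 to $K$. For $\sigma=K|L$, the dual cell is $D_\sigma=D_{\sigma,K}\cup D_{\sigma,L}$, where $D_{\sigma,K}$ is the half of $K$ adjacent to $\sigma$ ($|D_{\sigma,K}|=|K|/2$); for an external $\sigma\in\mathcal E(K)$, $D_\sigma=D_{\sigma,K}$. $\tilde{\mathcal E}(D_\sigma)$ is the set of edges of $D_\sigma$; for $\sigma,\sigma'\in\mathcal E^{(i)}$, $\epsilon=D_\sigma|D_{\sigma'}$ is the dual edge separating $D_\sigma$ and $D_{\sigma'}$. Spaces. $L_{\mathcal M}(\Omega)$: real functions constant on each $K\in\mathcal M$ (values $q_K$). $\boldsymbol H_{\mathcal E,0}(\Omega)=\prod_{i=1}^dH^{(i)}_{\mathcal E,0}(\Omega)$, where $H^{(i)}_{\mathcal E,0}(\Omega)$ is the set of functions constant on each $D_\sigma$, $\sigma\in\mathcal E^{(i)}$ (values $u_\sigma$), with $u_\sigma=0$ for external $\sigma$. For $q\in L_{\mathcal M}(\Omega)$ and $\sigma=K|L$: $|D_\sigma|q_{D_\sigma}=|D_{\sigma,K}|q_K+|D_{\sigma,L}|q_L$. Operators. $(\partial^{(i)}_{\mathcal E}q)_\sigma=\frac{|\sigma|}{|D_\sigma|}(q_L-q_K)\,\boldsymbol e^{(i)}\cdot\boldsymbol\nu_{\sigma,K}$ for $\sigma=K|L\in\mathcal E^{(i)}_{\mathrm{int}}$, and $0$ on external edges. For real $a$, $a^\pm=\frac12(a\pm|a|)$ (so $a^-\le0$). The pressure is $p(\rho)=\rho^\gamma$ and $p^{n+1}_K=p(\rho^{n+1}_K)$.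 Stabilised velocity. $v^n_\sigma=u^n_\sigma-\delta u_\sigma(\rho^{n+1})$ with $\delta u_\sigma(\rho^{n+1})=\frac{\eta\,\delta t}{\varepsilon^2}(\partial^{(i)}_{\mathcal E}p^{n+1})_\sigma$ for $\sigma\in\mathcal E^{(i)}_{\mathrm{int}}$, $v^n_\sigma=0$ for external $\sigma$. For $w=u^n,v^n,\delta u$: $w_{\sigma,K}=w_\sigma\,\boldsymbol e^{(i)}\cdot\boldsymbol\nu_{\sigma,K}$. By convention the split parts of $v^n_{\sigma,K}$ are $(v^n_{\sigma,K})^+:=(u^n_{\sigma,K})^+-(\delta u_{\sigma,K}(\rho^{n+1}))^-\ge0$ and $(v^n_{\sigma,K})^-:=(u^n_{\sigma,K})^--(\delta u_{\sigma,K}(\rho^{n+1}))^+\le0$. Fluxes. For $\sigma=K|L$: $F_{\sigma,K}(\rho^{n+1},\boldsymbol v^n)=|\sigma|\{\rho^{n+1}_K(v^n_{\sigma,K})^++\rho^{n+1}_L(v^n_{\sigma,K})^-\}$; $F_{\sigma,K}=0$ for external $\sigma$. Dual fluxes $F_{\epsilon,\sigma}$, $\sigma=K|L\in\mathcal E^{(i)}_{\mathrm{int}}$, $\epsilon\in\tilde{\mathcal E}(D_\sigma)$: $F_{\epsilon,\sigma}=0$ if $\epsilon\subset\partial\Omega$; if $\epsilon$ is orthogonal to $\boldsymbol e^{(i)}$ and lies inside a cell $K$ whose two edges in $\mathcal E^{(i)}$ are $\sigma,\sigma'$, then $F_{\epsilon,\sigma}=\frac12(F_{\sigma',K}-F_{\sigma,K})$;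 if $\epsilon$ is parallel to $\boldsymbol e^{(i)}$, so that it is the union of a half of $\tau\in\mathcal E(K)$ and a half of $\tau'\in\mathcal E(L)$, then $F_{\epsilon,\sigma}=\frac12(F_{\tau,K}+F_{\tau',L})$. Upwind value: for $\epsilon=D_\sigma|D_{\sigma'}$, $u^n_{\epsilon,\mathrm{up}}=u^n_\sigma$ if $F_{\epsilon,\sigma}(\rho^{n+1},\boldsymbol v^n)\ge0$ and $u^n_{\sigma'}$ otherwise. Energy. $\psi_\gamma(\rho)=\rho\ln\rho$ if $\gamma=1$, $\psi_\gamma(\rho)=\rho^\gamma/(\gamma-1)$ if $\gamma>1$, and $\Pi_\gamma(\rho)=\psi_\gamma(\rho)-\psi_\gamma(1)-\psi_\gamma'(1)(\rho-1)$. *)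

theory Defs
  imports "HOL-Analysis.Analysis"
begin

type_synonym 'd cell = "(real ^ 'd) set"
type_synonym 'd edge = "(real ^ 'd) set"


section \<open>Axis-parallel boxes and their edges\<close>

abbreviation lo :: "(real ^ 'd) set \<Rightarrow> 'd \<Rightarrow> real" where
  "lo B i \<equiv> interval_lowerbound B $ i"

abbreviation hi :: "(real ^ 'd) set \<Rightarrow> 'd \<Rightarrow> real" where
  "hi B i \<equiv> interval_upperbound B $ i"

text \<open>The \<open>2 d\<close> edges of a box; used both for primal cells and for dual cells.\<close>

definition box_edges :: "(real ^ 'd) set \<Rightarrow> 'd edge set" where
  "box_edges B = (\<Union>i. {{x \<in> B. x $ i = lo B i}, {x \<in> B. x $ i = hi B i}})"

text \<open>The index \<open>i\<close> such that an edge is orthogonal to the \<open>i\<close>-th basis vector: the only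
  direction in which it is flat.\<close>

definition dir :: "('d::finite) edge \<Rightarrow> 'd" where
  "dir \<sigma> = (THE i. lo \<sigma> i = hi \<sigma> i)"

abbreviation vol :: "(real ^ 'd) set \<Rightarrow> real" where
  "vol A \<equiv> measure lborel A"

text \<open>The \<open>(d-1)\<close>-dimensional Lebesgue measure of an edge.\<close>

definition area :: "('d::finite) edge \<Rightarrow> real" where
  "area \<sigma> = (\<Prod>j \<in> UNIV - {dir \<sigma>}. hi \<sigma> j - lo \<sigma> j)"

definition outer_normal :: "'d edge \<Rightarrow> 'd cell \<Rightarrow> real ^ 'd" where
  "outer_normal \<sigma> K =
     (if lo \<sigma> (dir \<sigma>) = hi K (dir \<sigma>) then axis (dir \<sigma>) 1 else - axis (dir \<sigma>) 1)"


section \<open>MAC grids\<close>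

definition edges :: "('d::finite) cell set \<Rightarrow> 'd edge set" where
  "edges M = (\<Union>K\<in>M. box_edges K)"

definition ext_edges :: "(real ^ 'd) set \<Rightarrow> 'd cell set \<Rightarrow> 'd edge set" where
  "ext_edges \<Omega> M = {\<sigma> \<in> edges M. \<sigma> \<subseteq> frontier \<Omega>}"

definition int_edges :: "(real ^ 'd) set \<Rightarrow> 'd cell set \<Rightarrow> 'd edge set" where
  "int_edges \<Omega> M = {\<sigma> \<in> edges M. \<not> \<sigma> \<subseteq> frontier \<Omega>}"

definition int_edges_dir :: "(real ^ 'd) set \<Rightarrow> 'd cell set \<Rightarrow> 'd \<Rightarrow> 'd edge set" where
  "int_edges_dir \<Omega> M i = {\<sigma> \<in> int_edges \<Omega> M. dir \<sigma> = i}"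

text \<open>``Structured'' is the requirement that cells meet face to face, so that there are no
  hanging nodes; for axis-parallel boxes this makes the mesh locally a (non-uniform) product grid.
  The last clause says that the mesh resolves the boundary. It holds automatically
  when \<open>\<Omega>\<close> is the interior of its closure; otherwise it makes any slit in \<open>\<Omega>\<close> a union of
  edges, so that every edge is either contained in the boundary or separates two cells.\<close>

definition mac_grid :: "(real ^ 'd) set \<Rightarrow> 'd cell set \<Rightarrow> bool" where
  "mac_grid \<Omega> M \<longleftrightarrow>
     CARD('d) \<in> {2, 3} \<and>
     open \<Omega> \<and> bounded \<Omega> \<and> connected \<Omega> \<and>
     M division_of closure \<Omega> \<and>
     (\<forall>K\<in>M. interior K \<noteq> {}) \<and>
     (\<forall>K\<in>M. \<forall>L\<in>M. (K \<inter> L) face_of K) \<and>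
     \<Union>(ext_edges \<Omega> M) = frontier \<Omega>"

text \<open>For an internal edge \<open>\<sigma> = K|L\<close>, \<open>cell_before\<close> selects as \<open>K\<close> the cell from which the basis
  vector orthogonal to \<open>\<sigma>\<close> points outwards, and \<open>opposite M \<sigma>\<close> exchanges \<open>K\<close> and \<open>L\<close>. All formulas
  below that start from \<open>cell_before\<close> are symmetric in \<open>K\<close> and \<open>L\<close>.\<close>

definition cell_before :: "('d::finite) cell set \<Rightarrow> 'd edge \<Rightarrow> 'd cell" where
  "cell_before M \<sigma> = (THE K. K \<in> M \<and> \<sigma> \<in> box_edges K \<and> lo \<sigma> (dir \<sigma>) = hi K (dir \<sigma>))"

definition opposite :: "('d::finite) cell set \<Rightarrow> 'd edge \<Rightarrow> 'd cell \<Rightarrow> 'd cell" where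
  "opposite M \<sigma> K = (THE L. L \<in> M \<and> \<sigma> \<in> box_edges L \<and> L \<noteq> K)"

definition half_cell :: "'d edge \<Rightarrow> 'd cell \<Rightarrow> (real ^ 'd) set" where
  "half_cell \<sigma> K =
     {x \<in> K. \<bar>x $ dir \<sigma> - lo \<sigma> (dir \<sigma>)\<bar> \<le> (hi K (dir \<sigma>) - lo K (dir \<sigma>)) / 2}"

definition dual_cell :: "'d cell set \<Rightarrow> 'd edge \<Rightarrow> (real ^ 'd) set" where
  "dual_cell M \<sigma> = (\<Union>K \<in> {K \<in> M. \<sigma> \<in> box_edges K}. half_cell \<sigma> K)"

text \<open>The edge \<open>\<sigma>'\<close> with \<open>e = D\<^sub>\<sigma>|D\<^sub>\<sigma>\<^sub>'\<close>. At a re-entrant corner \<open>\<sigma>'\<close> may be external and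
  its dual cell may cover only half of \<open>e\<close>, hence the condition on dimensions.\<close>

definition dual_neighbour :: "'d cell set \<Rightarrow> (real ^ 'd) set \<Rightarrow> 'd edge \<Rightarrow> 'd edge" where
  "dual_neighbour M e \<sigma> =
     (THE \<sigma>'. \<sigma>' \<in> edges M \<and> dir \<sigma>' = dir \<sigma> \<and> \<sigma>' \<noteq> \<sigma> \<and>
              aff_dim (e \<inter> dual_cell M \<sigma>') = int CARD('d) - 1)"


section \<open>Discrete functions and operators\<close>

text \<open>A function that is constant on each primal cell is given by its family of
  values, a function on cells. Likewise a discrete velocity is given by one value per edge;
  as each edge has exactly one direction, one function on all edges encodes all \<open>d\<close> components.\<close>

definition H0 :: "(real ^ 'd) set \<Rightarrow> 'd cell set \<Rightarrow> ('d edge \<Rightarrow> real) set" where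
  "H0 \<Omega> M = {u. \<forall>\<sigma>\<in>ext_edges \<Omega> M. u \<sigma> = 0}"

definition dual_mean :: "('d::finite) cell set \<Rightarrow> ('d cell \<Rightarrow> real) \<Rightarrow> 'd edge \<Rightarrow> real" where
  "dual_mean M q \<sigma> =
     (let K = cell_before M \<sigma>; L = opposite M \<sigma> K
      in (vol (half_cell \<sigma> K) * q K + vol (half_cell \<sigma> L) * q L) / vol (dual_cell M \<sigma>))"

definition partial_deriv ::
    "(real ^ 'd) set \<Rightarrow> 'd cell set \<Rightarrow> 'd \<Rightarrow> ('d cell \<Rightarrow> real) \<Rightarrow> 'd edge \<Rightarrow> real" where
  "partial_deriv \<Omega> M i q \<sigma> =
     (if \<sigma> \<in> int_edges_dir \<Omega> M i
      then let K = cell_before M \<sigma>; L = opposite M \<sigma> K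
           in area \<sigma> / vol (dual_cell M \<sigma>) * (q L - q K) * (axis i 1 \<bullet> outer_normal \<sigma> K)
      else 0)"

definition pos_part :: "real \<Rightarrow> real" where
  "pos_part a = (a + \<bar>a\<bar>) / 2"

text \<open>Note that the negative part is nonpositive here.\<close>

definition neg_part :: "real \<Rightarrow> real" where
  "neg_part a = (a - \<bar>a\<bar>) / 2"

definition pressure :: "real \<Rightarrow> real \<Rightarrow> real" where
  "pressure \<gamma> r = r powr \<gamma>"


section \<open>Stabilised velocity\<close>

text \<open>In the following, \<open>\<rho>\<close> is the density at the new time step and \<open>u\<close> the
  velocity at the old one.\<close>

definition vel_shift :: "(real ^ 'd) set \<Rightarrow> 'd cell set \<Rightarrow> real \<Rightarrow> real \<Rightarrow> real \<Rightarrow> real \<Rightarrow>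
    ('d cell \<Rightarrow> real) \<Rightarrow> 'd edge \<Rightarrow> real" where
  "vel_shift \<Omega> M \<gamma> \<eta> \<epsilon> \<delta>t \<rho> \<sigma> =
     \<eta> * \<delta>t / \<epsilon>\<^sup>2 * partial_deriv \<Omega> M (dir \<sigma>) (\<lambda>K. pressure \<gamma> (\<rho> K)) \<sigma>"

definition stab_vel :: "(real ^ 'd) set \<Rightarrow> 'd cell set \<Rightarrow> real \<Rightarrow> real \<Rightarrow> real \<Rightarrow> real \<Rightarrow>
    ('d cell \<Rightarrow> real) \<Rightarrow> ('d edge \<Rightarrow> real) \<Rightarrow> 'd edge \<Rightarrow> real" where
  "stab_vel \<Omega> M \<gamma> \<eta> \<epsilon> \<delta>t \<rho> u \<sigma> =
     (if \<sigma> \<in> int_edges \<Omega> M then u \<sigma> - vel_shift \<Omega> M \<gamma> \<eta> \<epsilon> \<delta>t \<rho> \<sigma> else 0)"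

definition normal_comp :: "(('d::finite) edge \<Rightarrow> real) \<Rightarrow> 'd edge \<Rightarrow> 'd cell \<Rightarrow> real" where
  "normal_comp w \<sigma> K = w \<sigma> * (axis (dir \<sigma>) 1 \<bullet> outer_normal \<sigma> K)"

text \<open>The split parts of the stabilised velocity are a convention: they are not the positive and
  negative parts of \<open>normal_comp (stab_vel \<dots>) \<sigma> K\<close>, but they do sum up to it.\<close>

definition vel_plus :: "(real ^ 'd) set \<Rightarrow> 'd cell set \<Rightarrow> real \<Rightarrow> real \<Rightarrow> real \<Rightarrow> real \<Rightarrow>
    ('d cell \<Rightarrow> real) \<Rightarrow> ('d edge \<Rightarrow> real) \<Rightarrow> 'd edge \<Rightarrow> 'd cell \<Rightarrow> real" where
  "vel_plus \<Omega> M \<gamma> \<eta> \<epsilon> \<delta>t \<rho> u \<sigma> K =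
     pos_part (normal_comp u \<sigma> K) - neg_part (normal_comp (vel_shift \<Omega> M \<gamma> \<eta> \<epsilon> \<delta>t \<rho>) \<sigma> K)"

definition vel_minus :: "(real ^ 'd) set \<Rightarrow> 'd cell set \<Rightarrow> real \<Rightarrow> real \<Rightarrow> real \<Rightarrow> real \<Rightarrow>
    ('d cell \<Rightarrow> real) \<Rightarrow> ('d edge \<Rightarrow> real) \<Rightarrow> 'd edge \<Rightarrow> 'd cell \<Rightarrow> real" where
  "vel_minus \<Omega> M \<gamma> \<eta> \<epsilon> \<delta>t \<rho> u \<sigma> K =
     neg_part (normal_comp u \<sigma> K) - pos_part (normal_comp (vel_shift \<Omega> M \<gamma> \<eta> \<epsilon> \<delta>t \<rho>) \<sigma> K)"

lemma vel_plus_add_vel_minus: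
  assumes "\<sigma> \<in> int_edges \<Omega> M"
  shows "vel_plus \<Omega> M \<gamma> \<eta> \<epsilon> \<delta>t \<rho> u \<sigma> K + vel_minus \<Omega> M \<gamma> \<eta> \<epsilon> \<delta>t \<rho> u \<sigma> K =
         normal_comp (stab_vel \<Omega> M \<gamma> \<eta> \<epsilon> \<delta>t \<rho> u) \<sigma> K"
  using assms
  by (simp add: vel_plus_def vel_minus_def stab_vel_def normal_comp_def pos_part_def neg_part_def
      field_simps)


section \<open>Fluxes\<close>

definition flux :: "(real ^ 'd) set \<Rightarrow> 'd cell set \<Rightarrow> real \<Rightarrow> real \<Rightarrow> real \<Rightarrow> real \<Rightarrow>
    ('d cell \<Rightarrow> real) \<Rightarrow> ('d edge \<Rightarrow> real) \<Rightarrow> 'd edge \<Rightarrow> 'd cell \<Rightarrow> real" where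
  "flux \<Omega> M \<gamma> \<eta> \<epsilon> \<delta>t \<rho> u \<sigma> K =
     (if \<sigma> \<in> int_edges \<Omega> M
      then area \<sigma> * (\<rho> K * vel_plus \<Omega> M \<gamma> \<eta> \<epsilon> \<delta>t \<rho> u \<sigma> K +
                     \<rho> (opposite M \<sigma> K) * vel_minus \<Omega> M \<gamma> \<eta> \<epsilon> \<delta>t \<rho> u \<sigma> K)
      else 0)"

text \<open>In the last case, \<open>e \<inter> K\<close> and \<open>e \<inter> L\<close> are the halves of \<open>\<tau>\<close> and \<open>\<tau>'\<close> that make up \<open>e\<close>.\<close>

definition dual_flux :: "(real ^ 'd) set \<Rightarrow> 'd cell set \<Rightarrow> real \<Rightarrow> real \<Rightarrow> real \<Rightarrow> real \<Rightarrow>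
    ('d cell \<Rightarrow> real) \<Rightarrow> ('d edge \<Rightarrow> real) \<Rightarrow> (real ^ 'd) set \<Rightarrow> 'd edge \<Rightarrow> real" where
  "dual_flux \<Omega> M \<gamma> \<eta> \<epsilon> \<delta>t \<rho> u e \<sigma> =
     (if e \<subseteq> frontier \<Omega> then 0
      else if dir e = dir \<sigma>
      then let K = (THE K. K \<in> M \<and> e \<subseteq> K);
               \<sigma>' = (THE \<sigma>'. \<sigma>' \<in> box_edges K \<and> dir \<sigma>' = dir \<sigma> \<and> \<sigma>' \<noteq> \<sigma>)
           in (flux \<Omega> M \<gamma> \<eta> \<epsilon> \<delta>t \<rho> u \<sigma>' K - flux \<Omega> M \<gamma> \<eta> \<epsilon> \<delta>t \<rho> u \<sigma> K) / 2
      else let K = cell_before M \<sigma>; L = opposite M \<sigma> K;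
               \<tau> = (THE \<tau>. \<tau> \<in> box_edges K \<and> e \<inter> K \<subseteq> \<tau>);
               \<tau>' = (THE \<tau>'. \<tau>' \<in> box_edges L \<and> e \<inter> L \<subseteq> \<tau>')
           in (flux \<Omega> M \<gamma> \<eta> \<epsilon> \<delta>t \<rho> u \<tau> K + flux \<Omega> M \<gamma> \<eta> \<epsilon> \<delta>t \<rho> u \<tau>' L) / 2)"

definition upwind :: "(real ^ 'd) set \<Rightarrow> 'd cell set \<Rightarrow> real \<Rightarrow> real \<Rightarrow> real \<Rightarrow> real \<Rightarrow>
    ('d cell \<Rightarrow> real) \<Rightarrow> ('d edge \<Rightarrow> real) \<Rightarrow> (real ^ 'd) set \<Rightarrow> 'd edge \<Rightarrow> real" where
  "upwind \<Omega> M \<gamma> \<eta> \<epsilon> \<delta>t \<rho> u e \<sigma> =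
     (if dual_flux \<Omega> M \<gamma> \<eta> \<epsilon> \<delta>t \<rho> u e \<sigma> \<ge> 0 then u \<sigma> else u (dual_neighbour M e \<sigma>))"


section \<open>Energy\<close>

definition psi :: "real \<Rightarrow> real \<Rightarrow> real" where
  "psi \<gamma> r = (if \<gamma> = 1 then r * ln r else r powr \<gamma> / (\<gamma> - 1))"

definition Pi_energy :: "real \<Rightarrow> real \<Rightarrow> real" where
  "Pi_energy \<gamma> r = psi \<gamma> r - psi \<gamma> 1 - deriv (psi \<gamma>) 1 * (r - 1)"

end

theory Submission imports Defs begin

text \<open>Multiplying the mass balance by \<open>psi' \<rho> - psi' 1\<close> and using convexity of \<open>psi\<close>, the
  internal energy changes by at most the work of the pressure gradient against the stabilised
  velocity \<open>v\<close>. Multiplying the momentum balance by the old velocity \<open>u\<close>, the kinetic energy changes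
  by minus the work against \<open>u\<close>, plus \<open>\<rho> (u' - u)\<^sup>2 / 2\<close>, minus the dissipation of the upwinding. By
  the CFL condition the upwind part of \<open>u' - u\<close> is absorbed by the dissipation, and by the lower
  bound on \<open>\<eta>\<close> the pressure part is what turns \<open>u\<close> into \<open>v\<close>. So the two works cancel.

  Summing over the edges requires that the dual fluxes satisfy a mass balance and are conservative.
  The involution \<open>(\<sigma>, e) \<mapsto> (\<sigma>', e)\<close> with \<open>e = D\<^sub>\<sigma>|D\<^sub>\<sigma>\<^sub>'\<close> makes the upwind energy
  fluxes cancel in pairs; where \<open>\<sigma>'\<close> is external, the energy flux out of \<open>D\<^sub>\<sigma>\<close> is nonnegative because
  \<open>u\<close> vanishes at \<open>\<sigma>'\<close>.\<close>

section \<open>Energy estimates for a single edge\<close>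

text \<open>Both stability conditions come from one use of Young's inequality: separating the upwind
  and pressure parts of the velocity increment costs a factor two, which the CFL constant 1/2
  compensates, and the remaining pressure term is bounded by \<open>\<eta>\<close>. The two-sided
  split of \<open>v\<close> is what lets convexity act on each flux part with a known sign. Most of
  the length is geometry. Normals, opposite cells, dual neighbours and the cells entering a dual
  flux are selected by definite descriptions over point sets, so each must be shown to pick the
  intended object. For this an internal edge is described by \<open>nb K i s L\<close>: crossing
  side \<open>s\<close> in direction \<open>i\<close> leads from the cell \<open>K\<close> to
  \<open>L\<close>. All such terms are then evaluated from the coordinates of \<open>K\<close> and
  \<open>L\<close>. The delicate places are slits, where a face with a cell on both sides is
  external, and re-entrant corners, where only part of a dual edge may touch the neighbouring dual
  cell. Arguments there choose a generic point that avoids all other mesh planes.\<close>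

lemma weighted_Cauchy_Schwarz:
  fixes N z :: "'e \<Rightarrow> real"
  assumes "\<And>e. e \<in> E \<Longrightarrow> N e \<ge> 0"
  shows "(\<Sum>e\<in>E. N e * z e)\<^sup>2 \<le> (\<Sum>e\<in>E. N e) * (\<Sum>e\<in>E. N e * (z e)\<^sup>2)"
proof -
  have "(\<Sum>e\<in>E. N e * z e) = (\<Sum>e\<in>E. sqrt (N e) * (sqrt (N e) * z e))"
    using assms by (intro sum.cong refl) (simp add: mult.assoc[symmetric])
  also have "\<dots>\<^sup>2 \<le> (\<Sum>e\<in>E. (sqrt (N e))\<^sup>2) * (\<Sum>e\<in>E. (sqrt (N e) * z e)\<^sup>2)"
    by (rule Cauchy_Schwarz_ineq_sum)
  also have "\<dots> = (\<Sum>e\<in>E. N e) * (\<Sum>e\<in>E. N e * (z e)\<^sup>2)"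
    using assms by (intro arg_cong2[where f = "(*)"] sum.cong refl) (auto simp: power_mult_distrib)
  finally show ?thesis .
qed

text \<open>Here \<open>F\<close> are the dual fluxes, \<open>w e\<close> the velocity beyond
  \<open>e\<close> and \<open>P\<close> the scaled pressure gradient. Because of
  \<open>mass\<close>, the terms quadratic in the old velocity \<open>u\<close> cancel, leaving the
  work of \<open>u\<close>, the squared increment and the dissipation.\<close>

lemma kinetic_step:
  fixes F w :: "'e \<Rightarrow> real" and D r\<^sub>0 r\<^sub>1 u u\<^sub>1 P \<eta> \<delta> :: real
  defines "up \<equiv> \<lambda>e. if F e \<ge> 0 then u else w e"
  assumes pos: "D > 0" "r\<^sub>1 > 0" "\<delta> > 0"
    and mass: "D * (r\<^sub>1 - r\<^sub>0) / \<delta> + (\<Sum>e\<in>E. F e) = 0"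
    and momentum: "1 / \<delta> * (r\<^sub>1 * u\<^sub>1 - r\<^sub>0 * u) + 1 / D * (\<Sum>e\<in>E. F e * up e) + P = 0"
    and cfl: "\<delta> / D * (\<Sum>e\<in>E. - neg_part (F e) / r\<^sub>1) \<le> 1 / 2"
    and eta: "\<eta> \<ge> 1 / r\<^sub>1"
  shows "D * (1/2) * r\<^sub>1 * u\<^sub>1\<^sup>2 - D * (1/2) * r\<^sub>0 * u\<^sup>2 + \<delta> / 2 * (\<Sum>e\<in>E. F e * (up e)\<^sup>2)
     \<le> - (\<delta> * (D * P * (u - \<eta> * \<delta> * P)))"
proof -
  define N where "N e = - neg_part (F e)" for e
  define S where "S = (\<Sum>e\<in>E. N e)"
  define A where "A = (\<Sum>e\<in>E. N e * (w e - u))"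
  define B where "B = (\<Sum>e\<in>E. N e * (w e - u)\<^sup>2)"
  define d where "d = u\<^sub>1 - u"
  have N_eq: "N e = (if F e \<ge> 0 then 0 else - F e)" for e by (simp add: N_def neg_part_def)
  have N0: "N e \<ge> 0" for e by (simp add: N_eq)
  have AB: "A\<^sup>2 \<le> S * B"
    unfolding A_def S_def B_def by (rule weighted_Cauchy_Schwarz) (rule N0)
  have B0: "B \<ge> 0" unfolding B_def by (intro sum_nonneg mult_nonneg_nonneg N0) simp
  \<comment> \<open>Only incoming fluxes see a value other than \<open>u\<close>. Their contribution
    is collected in \<open>A\<close>, and \<open>B\<close> is the corresponding dissipation.\<close>
  have "F e * up e = F e * u - N e * (w e - u)" for e
    by (simp add: up_def N_eq algebra_simps)
  then have up1: "(\<Sum>e\<in>E. F e * up e) = (\<Sum>e\<in>E. F e) * u - A"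
    by (simp add: A_def sum_subtractf sum_distrib_right)
  have "F e * (up e)\<^sup>2 = F e * u\<^sup>2 - N e * (w e - u)\<^sup>2 - 2 * u * (N e * (w e - u))" for e
    by (simp add: up_def N_eq algebra_simps power2_eq_square)
  then have up2: "(\<Sum>e\<in>E. F e * (up e)\<^sup>2) = (\<Sum>e\<in>E. F e) * u\<^sup>2 - B - 2 * u * A"
    by (simp add: A_def B_def sum_subtractf sum_distrib_right sum_distrib_left)
  have Phi: "(\<Sum>e\<in>E. F e) = - (D * (r\<^sub>1 - r\<^sub>0) / \<delta>)" using mass by simp
  have eq: "D * r\<^sub>1 * d = \<delta> * (A - D * P)"
    using momentum pos unfolding up1 Phi d_def by (simp add: field_simps)
  have "\<delta> / D * (S / r\<^sub>1) \<le> 1 / 2"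
    using cfl by (simp add: S_def N_def sum_divide_distrib)
  then have S: "\<delta> * S / (D * r\<^sub>1) \<le> 1 / 2" by simp
  have "D * r\<^sub>1 * d\<^sup>2 / 2 = (D * r\<^sub>1 * d)\<^sup>2 / (2 * D * r\<^sub>1)"
    using pos by (simp add: field_simps power2_eq_square)
  also have "\<dots> = \<delta>\<^sup>2 * ((A - D * P)\<^sup>2 / 2) / (D * r\<^sub>1)"
    unfolding eq by (simp add: power_mult_distrib)
  also have "\<dots> \<le> \<delta>\<^sup>2 * (A\<^sup>2 + (D * P)\<^sup>2) / (D * r\<^sub>1)"
  proof (intro divide_right_mono mult_left_mono)
    \<comment> \<open>Young's inequality; this loss of a factor two is the origin of 1/2 in the CFL
      condition.\<close>
    show "(A - D * P)\<^sup>2 / 2 \<le> A\<^sup>2 + (D * P)\<^sup>2"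
      using zero_le_power2[of "A + D * P"] by (simp add: power2_eq_square algebra_simps)
  qed (use pos in auto)
  also have "\<dots> \<le> \<delta>\<^sup>2 * (S * B + (D * P)\<^sup>2) / (D * r\<^sub>1)"
    using pos AB by (intro divide_right_mono mult_left_mono) auto
  also have "\<dots> = \<delta> * B * (\<delta> * S / (D * r\<^sub>1)) + \<delta>\<^sup>2 * D * P\<^sup>2 * (1 / r\<^sub>1)"
    using pos by (simp add: field_simps power2_eq_square)
  \<comment> \<open>The first term is exactly the available dissipation, the second exactly the
    difference between the works against \<open>u\<close> and against
    \<open>u - \<eta> * \<delta> * P\<close>.\<close>
  also have "\<dots> \<le> \<delta> * B * (1 / 2) + \<delta>\<^sup>2 * D * P\<^sup>2 * \<eta>"
    using pos B0 by (intro add_mono mult_left_mono S eta) auto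
  finally have key: "D * r\<^sub>1 * d\<^sup>2 / 2 \<le> \<delta> * B / 2 + \<delta>\<^sup>2 * D * P\<^sup>2 * \<eta>" by simp
  have u1: "u\<^sub>1 = u + d" by (simp add: d_def)
  have "D * (1/2) * r\<^sub>1 * u\<^sub>1\<^sup>2 - D * (1/2) * r\<^sub>0 * u\<^sup>2 + \<delta> / 2 * (\<Sum>e\<in>E. F e * (up e)\<^sup>2)
     = u * (D * r\<^sub>1 * d) + D * r\<^sub>1 * d\<^sup>2 / 2 - \<delta> * B / 2 - \<delta> * u * A"
    unfolding up2 Phi u1 using pos by (simp add: field_simps power2_eq_square)
  also have "\<dots> \<le> - (\<delta> * (D * P * (u - \<eta> * \<delta> * P)))"
    unfolding eq using key by (simp add: algebra_simps power2_eq_square)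
  finally show ?thesis .
qed

section \<open>Convexity of the internal energy and the work of the pressure\<close>

definition psi_deriv :: "real \<Rightarrow> real \<Rightarrow> real" where
  "psi_deriv \<gamma> r = (if \<gamma> = 1 then ln r + 1 else \<gamma> / (\<gamma> - 1) * r powr (\<gamma> - 1))"

lemma has_real_derivative_psi:
  assumes "r > 0"
  shows "(psi \<gamma> has_real_derivative psi_deriv \<gamma> r) (at r)"
proof (cases "\<gamma> = 1")
  case True
  have "((\<lambda>r. r * ln r) has_real_derivative (ln r + 1)) (at r)"
    using assms by (auto intro!: derivative_eq_intros)
  moreover have "psi \<gamma> = (\<lambda>r. r * ln r)" using True by (simp add: psi_def fun_eq_iff)
  ultimately show ?thesis using True by (simp add: psi_deriv_def)
next
  case False
  have "((\<lambda>r. r powr \<gamma> / (\<gamma> - 1)) has_real_derivative (\<gamma> * r powr (\<gamma> - 1) / (\<gamma> - 1))) (at r)"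
    using assms False by (auto intro!: derivative_eq_intros simp: powr_diff)
  moreover have "psi \<gamma> = (\<lambda>r. r powr \<gamma> / (\<gamma> - 1))" using False by (simp add: psi_def fun_eq_iff)
  ultimately show ?thesis using False by (simp add: psi_deriv_def)
qed

lemma psi_above_tangent:
  assumes "\<gamma> \<ge> 1" "a > 0" "b > 0"
  shows "psi_deriv \<gamma> b * (a - b) \<le> psi \<gamma> a - psi \<gamma> b"
proof -
  have "convex_on {0<..} (psi \<gamma>)"
  proof (rule convex_on_realI)
    fix x y :: real assume "x \<in> {0<..}" "y \<in> {0<..}" "x \<le> y"
    then show "psi_deriv \<gamma> x \<le> psi_deriv \<gamma> y"
      using assms(1) by (auto simp: psi_deriv_def intro!: divide_right_mono mult_left_mono powr_mono2)
  qed (auto intro: has_real_derivative_psi)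
  then have "psi \<gamma> a - psi \<gamma> b \<ge> psi_deriv \<gamma> b * (a - b)"
    using assms
    by (intro convex_on_imp_above_tangent[where A = "{0<..}"])
       (auto simp: interior_open intro: has_field_derivative_at_within has_real_derivative_psi)
  then show ?thesis .
qed

lemma mult_psi_deriv:
  assumes "r > 0"
  shows "r * psi_deriv \<gamma> r = psi \<gamma> r + pressure \<gamma> r"
  using assms
  by (auto simp: psi_deriv_def psi_def pressure_def powr_diff field_simps)

text \<open>Both \<open>a * (psi' a - psi' b) - (p a - p b)\<close> and \<open>(p a - p b) - b * (psi' a - psi' b)\<close> are
  Bregman distances of \<open>psi\<close>, as \<open>p r = r * psi' r - psi r\<close>.\<close>

lemma pressure_work_le:
  assumes "\<gamma> \<ge> 1" "a > 0" "b > 0" "vp \<ge> 0" "vm \<le> 0"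
  shows "(pressure \<gamma> a - pressure \<gamma> b) * (vp + vm)
       \<le> (a * vp + b * vm) * (psi_deriv \<gamma> a - psi_deriv \<gamma> b)"
proof -
  have 1: "pressure \<gamma> a - pressure \<gamma> b \<le> a * (psi_deriv \<gamma> a - psi_deriv \<gamma> b)"
    using psi_above_tangent[OF assms(1-3)] mult_psi_deriv[OF assms(2), of \<gamma>]
      mult_psi_deriv[OF assms(3), of \<gamma>] by (simp add: algebra_simps)
  have 2: "b * (psi_deriv \<gamma> a - psi_deriv \<gamma> b) \<le> pressure \<gamma> a - pressure \<gamma> b"
    using psi_above_tangent[OF assms(1,3,2)] mult_psi_deriv[OF assms(2), of \<gamma>]
      mult_psi_deriv[OF assms(3), of \<gamma>] by (simp add: algebra_simps)
  \<comment> \<open>The bounds on the pressure difference point in opposite directions; the signs of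
    \<open>vp\<close> and \<open>vm\<close> align them.\<close>
  have "(pressure \<gamma> a - pressure \<gamma> b) * vp \<le> a * (psi_deriv \<gamma> a - psi_deriv \<gamma> b) * vp"
    using 1 assms(4) by (rule mult_right_mono)
  moreover have "(pressure \<gamma> a - pressure \<gamma> b) * vm \<le> b * (psi_deriv \<gamma> a - psi_deriv \<gamma> b) * vm"
    using 2 assms(5) by (rule mult_right_mono_neg)
  ultimately show ?thesis by (simp add: algebra_simps)
qed

text \<open>The tangent is taken at the new density \<open>a\<close>, since the mass flux is
  implicit in the density. The affine part of \<open>Pi_energy\<close> only shifts the
  slope.\<close>

lemma Pi_energy_diff_le:
  assumes "\<gamma> \<ge> 1" "a > 0" "b > 0"
  shows "Pi_energy \<gamma> a - Pi_energy \<gamma> b \<le> (psi_deriv \<gamma> a - psi_deriv \<gamma> 1) * (a - b)"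
proof -
  have "deriv (psi \<gamma>) 1 = psi_deriv \<gamma> 1"
    by (rule DERIV_imp_deriv) (rule has_real_derivative_psi, simp)
  then show ?thesis
    using psi_above_tangent[OF assms(1,3,2)] by (simp add: Pi_energy_def algebra_simps)
qed

section \<open>Boxes and their faces\<close>

text \<open>Strict extent in every direction makes each face flat in exactly one direction, so that
  \<open>dir\<close> is well defined, and keeps opposite faces distinct.\<close>

definition fat_box :: "(real ^ 'd::finite) set \<Rightarrow> bool" where
  "fat_box B \<longleftrightarrow> (\<exists>a b. B = cbox a b \<and> (\<forall>k. a $ k < b $ k))"

text \<open>A face is given by its direction \<open>i\<close> and its side \<open>s\<close>, which is \<open>True\<close> for the upper one.\<close>

definition bound :: "(real ^ 'd::finite) set \<Rightarrow> 'd \<Rightarrow> bool \<Rightarrow> real" where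
  "bound B i s = (if s then hi B i else lo B i)"

definition face :: "(real ^ 'd::finite) set \<Rightarrow> 'd \<Rightarrow> bool \<Rightarrow> (real ^ 'd) set" where
  "face B i s = {x \<in> B. x $ i = bound B i s}"

definition mid :: "(real ^ 'd::finite) set \<Rightarrow> 'd \<Rightarrow> real" where
  "mid B i = (lo B i + hi B i) / 2"

lemma cbox_bounds:
  fixes a b :: "real ^ 'd::finite"
  assumes "\<And>k. a $ k \<le> b $ k"
  shows "interval_lowerbound (cbox a b) = a" "interval_upperbound (cbox a b) = b"
proof -
  have "cbox a b \<noteq> {}" using assms by (auto simp: interval_eq_empty_cart not_less)
  then show "interval_lowerbound (cbox a b) = a" "interval_upperbound (cbox a b) = b" by simp_all
qed

lemma fat_boxE:
  assumes "fat_box B"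
  shows "B = cbox (interval_lowerbound B) (interval_upperbound B)" "lo B k < hi B k"
proof -
  obtain a b where "B = cbox a b" and ab: "\<And>k. a $ k < b $ k"
    using assms by (auto simp: fat_box_def)
  moreover have "interval_lowerbound (cbox a b) = a" "interval_upperbound (cbox a b) = b"
    using ab by (auto intro!: cbox_bounds less_imp_le)
  ultimately show "B = cbox (interval_lowerbound B) (interval_upperbound B)" "lo B k < hi B k"
    by simp_all
qed

lemma fat_box_cbox: "(\<And>k. a $ k < b $ k) \<Longrightarrow> fat_box (cbox a b)"
  by (auto simp: fat_box_def)

lemma mem_fat_box:
  assumes "fat_box B"
  shows "x \<in> B \<longleftrightarrow> (\<forall>k. lo B k \<le> x $ k \<and> x $ k \<le> hi B k)"
  by (subst fat_boxE(1)[OF assms]) (simp add: mem_box_cart)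

lemma fat_box_eqI:
  assumes "fat_box A" "fat_box B" "\<And>k. lo A k = lo B k" "\<And>k. hi A k = hi B k"
  shows "A = B"
  using assms by (auto simp: set_eq_iff mem_fat_box)

lemma mid_strict:
  assumes "fat_box B"
  shows "lo B i < mid B i" "mid B i < hi B i"
  using fat_boxE(2)[OF assms, of i] by (simp_all add: mid_def)

lemma bound_bounds:
  assumes "fat_box B"
  shows "lo B i \<le> bound B i s" "bound B i s \<le> hi B i"
  using fat_boxE(2)[OF assms, of i] by (simp_all add: bound_def)

lemma mem_face: "x \<in> face B i s \<longleftrightarrow> x \<in> B \<and> x $ i = bound B i s"
  by (simp add: face_def)

lemma face_subset: "face B i s \<subseteq> B" by (auto simp: face_def)

lemma box_edges_eq: "box_edges B = (\<lambda>(i, s). face B i s) ` UNIV"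
  unfolding box_edges_def face_def bound_def
proof (intro equalityI subsetI, goal_cases)
  case (1 e)
  then obtain i where "e = {x \<in> B. x $ i = lo B i} \<or> e = {x \<in> B. x $ i = hi B i}" by auto
  then show ?case
  proof
    assume "e = {x \<in> B. x $ i = lo B i}"
    then show ?case by (intro image_eqI[where x = "(i, False)"]) auto
  next
    assume "e = {x \<in> B. x $ i = hi B i}"
    then show ?case by (intro image_eqI[where x = "(i, True)"]) auto
  qed
qed auto

lemma face_in_box_edges [simp]: "face B i s \<in> box_edges B"
  by (auto simp: box_edges_eq)

lemma box_edgesE:
  assumes "\<sigma> \<in> box_edges B"
  obtains i s where "\<sigma> = face B i s"
  using assms by (auto simp: box_edges_eq)

lemma face_eq_cbox:
  assumes "fat_box B"
  shows "face B i s = cbox (\<chi> k. if k = i then bound B i s else lo B k)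
                           (\<chi> k. if k = i then bound B i s else hi B k)"
proof (rule set_eqI)
  fix x
  have "x \<in> face B i s \<longleftrightarrow> (\<forall>k. lo B k \<le> x $ k \<and> x $ k \<le> hi B k) \<and> x $ i = bound B i s"
    by (simp add: face_def mem_fat_box[OF assms])
  also have "\<dots> \<longleftrightarrow> (\<forall>k. (if k = i then bound B i s else lo B k) \<le> x $ k \<and>
      x $ k \<le> (if k = i then bound B i s else hi B k))" (is "?L \<longleftrightarrow> ?R")
  proof
    assume R: ?R
    then have "x $ i = bound B i s" by (metis order_antisym)
    moreover from this have "lo B k \<le> x $ k \<and> x $ k \<le> hi B k" for k
      using R[rule_format, of k] bound_bounds[OF assms, of i s] by (cases "k = i") auto
    ultimately show ?L by blast
  qed auto
  finally show "x \<in> face B i s \<longleftrightarrow> x \<in> cbox (\<chi> k. if k = i then bound B i s else lo B k)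
                           (\<chi> k. if k = i then bound B i s else hi B k)"
    by (simp add: mem_box_cart)
qed

lemma lo_hi_face:
  assumes "fat_box B"
  shows "lo (face B i s) k = (if k = i then bound B i s else lo B k)"
    "hi (face B i s) k = (if k = i then bound B i s else hi B k)"
proof -
  have "(\<chi> k. if k = i then bound B i s else lo B k) $ k \<le> (\<chi> k. if k = i then bound B i s else hi B k) $ k" for k
    using fat_boxE(2)[OF assms, of k] by simp
  note * = cbox_bounds[OF this]
  show "lo (face B i s) k = (if k = i then bound B i s else lo B k)"
    "hi (face B i s) k = (if k = i then bound B i s else hi B k)"
    unfolding face_eq_cbox[OF assms] * by simp_all
qed

lemma dir_face:
  assumes "fat_box B"
  shows "dir (face B i s) = i"
  unfolding dir_def
proof (rule the_equality)
  fix j assume "lo (face B i s) j = hi (face B i s) j"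
  then show "j = i"
    using fat_boxE(2)[OF assms, of j] by (auto simp: lo_hi_face[OF assms] split: if_splits)
qed (simp add: lo_hi_face[OF assms])

lemma face_inject:
  assumes "fat_box B"
  shows "face B i s = face B j t \<longleftrightarrow> i = j \<and> s = t"
proof
  assume eq: "face B i s = face B j t"
  then have "i = j" by (metis assms dir_face)
  moreover have "bound B i s = bound B j t" using eq \<open>i = j\<close> lo_hi_face(1)[OF assms] by metis
  ultimately show "i = j \<and> s = t"
    using fat_boxE(2)[OF assms, of i] by (auto simp: bound_def split: if_splits)
qed simp

text \<open>The free \<open>s\<close> decides which of two opposite faces comes first, so that the
  pairing can be aligned with the orientation of an edge.\<close>

lemma sum_box_edges:
  assumes "fat_box B"
  shows "(\<Sum>e\<in>box_edges B. f e) = (\<Sum>i\<in>UNIV. f (face B i s) + f (face B i (\<not> s)))"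
proof -
  have "inj (\<lambda>(i, s). face B i s)"
    by (auto simp: inj_on_def face_inject[OF assms])
  then have "(\<Sum>e\<in>box_edges B. f e) = (\<Sum>(i, s)\<in>UNIV. f (face B i s))"
    by (simp add: box_edges_eq sum.reindex case_prod_unfold)
  also have "\<dots> = (\<Sum>i\<in>UNIV. \<Sum>s\<in>UNIV. f (face B i s))"
    by (simp add: sum.cartesian_product)
  also have "\<dots> = (\<Sum>i\<in>UNIV. f (face B i s) + f (face B i (\<not> s)))"
    by (cases s) (auto simp: UNIV_bool algebra_simps)
  finally show ?thesis .
qed

lemma finite_box_edges [simp]: "finite (box_edges B)"
  by (simp add: box_edges_eq)

lemma cbox_not_subset_face:
  assumes "fat_box B" "\<And>k. p $ k \<le> q $ k" "p $ i < q $ i"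
  shows "\<not> cbox p q \<subseteq> face B i s"
proof
  assume "cbox p q \<subseteq> face B i s"
  moreover have "p \<in> cbox p q" "q \<in> cbox p q" using assms by (auto simp: mem_box_cart)
  ultimately have "p $ i = bound B i s" "q $ i = bound B i s" by (auto simp: face_def)
  then show False using assms(3) by simp
qed

section \<open>Affine dimension of flat boxes\<close>

lemma hyperplane_cart: "{x :: real ^ 'd::finite. x $ j = c} = {x. axis j 1 \<bullet> x = c}"
  by (simp add: inner_axis')

lemma aff_dim_hyperplane_cart:
  "aff_dim {x :: real ^ 'd::finite. x $ j = c} = int CARD('d) - 1"
  by (simp add: hyperplane_cart aff_dim_hyperplane)

lemma aff_dim_two_hyperplanes:
  assumes "k \<noteq> j"
  shows "aff_dim {x :: real ^ 'd::finite. x $ j = c \<and> x $ k = c'} < int CARD('d) - 1"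
proof -
  let ?H = "{x :: real ^ 'd. x $ j = c}" and ?K = "{x :: real ^ 'd. axis k 1 \<bullet> x = c'}"
  have eq: "{x :: real ^ 'd. x $ j = c \<and> x $ k = c'} = ?H \<inter> ?K"
    by (auto simp: cart_eq_inner_axis inner_commute)
  have "(\<chi> l. if l = j then c else c' + 1) \<in> ?H - ?K"
    using assms by (auto simp: inner_axis')
  then have 1: "(?H \<subseteq> ?K) = False" by blast
  have "(\<chi> l. if l = j then c else c') \<in> ?H \<inter> ?K"
    using assms by (auto simp: inner_axis')
  then have 2: "(?H \<inter> ?K = {}) = False" by blast
  have "affine ?H" unfolding hyperplane_cart by (rule affine_hyperplane)
  from aff_dim_affine_Int_hyperplane[OF this, of "axis k 1" c']
  have "aff_dim (?H \<inter> ?K) = aff_dim ?H - 1"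
    unfolding 1 2 if_False .
  then show ?thesis by (simp add: eq aff_dim_hyperplane_cart)
qed

lemma aff_dim_flat_cbox:
  fixes p q :: "real ^ 'd::finite"
  assumes "p $ j = q $ j" "\<And>k. k \<noteq> j \<Longrightarrow> p $ k < q $ k"
  shows "aff_dim (cbox p q) = int CARD('d) - 1"
proof (rule antisym)
  have "x $ j = p $ j" if "x \<in> cbox p q" for x
    using assms(1) that[unfolded mem_box_cart, rule_format, of j] by simp
  then have "cbox p q \<subseteq> {x. x $ j = p $ j}" by blast
  then show "aff_dim (cbox p q) \<le> int CARD('d) - 1"
    by (metis aff_dim_subset aff_dim_hyperplane_cart)
  \<comment> \<open>The flat box is thickened by 1 in direction \<open>j\<close> to an open set. Its
    slice by the hyperplane is relatively open, hence of full dimension there, and lies in the flat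
    box.\<close>
  let ?T = "box (\<chi> k. if k = j then p $ j - 1 else p $ k) (\<chi> k. if k = j then p $ j + 1 else q $ k)"
  let ?H = "{x :: real ^ 'd. axis j 1 \<bullet> x = p $ j}"
  have "(\<chi> k. (p $ k + q $ k) / 2) \<in> ?H \<inter> ?T"
    using assms by (auto simp: mem_box_cart inner_axis' dest: assms(2))
  then have "aff_dim (?H \<inter> ?T) = aff_dim ?H"
    by (intro aff_dim_convex_Int_open[OF convex_hyperplane open_box]) blast
  moreover have "?H \<inter> ?T \<subseteq> cbox p q"
    using assms(1) by (auto simp: mem_box_cart inner_axis' split: if_splits)
       (metis less_eq_real_def)+
  ultimately show "int CARD('d) - 1 \<le> aff_dim (cbox p q)"
    using aff_dim_subset[of "?H \<inter> ?T" "cbox p q"] aff_dim_hyperplane_cart[of j "p $ j"]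
    unfolding hyperplane_cart by presburger
qed

text \<open>This turns the dimension condition in \<open>dual_neighbour\<close> into coordinates: a
  second direction of zero extent would put the box into two independent hyperplanes.\<close>

lemma flat_cbox_dim_cases:
  fixes p q :: "real ^ 'd::finite"
  assumes dim: "aff_dim (cbox p q) = int CARD('d) - 1" and card: "CARD('d) \<ge> 2"
    and sub: "cbox p q \<subseteq> {x. x $ j = c}"
  shows "p $ j = c" "q $ j = c" "k \<noteq> j \<Longrightarrow> p $ k < q $ k"
proof -
  \<comment> \<open>The empty set has affine dimension -1.\<close>
  have "cbox p q \<noteq> {}" using dim card by auto
  then have pq: "p $ k \<le> q $ k" for k by (auto simp: interval_eq_empty_cart not_less)
  then have "p \<in> cbox p q" "q \<in> cbox p q" by (auto simp: mem_box_cart)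
  then show "p $ j = c" "q $ j = c" using sub by auto
  show "p $ k < q $ k" if "k \<noteq> j"
  proof (rule ccontr)
    assume "\<not> p $ k < q $ k"
    then have "x $ k = p $ k" if "x \<in> cbox p q" for x
      using that[unfolded mem_box_cart, rule_format, of k] by simp
    then have "cbox p q \<subseteq> {x. x $ j = c \<and> x $ k = p $ k}" using sub by blast
    from aff_dim_subset[OF this] show False
      using aff_dim_two_hyperplanes[OF that, of c "p $ k"] dim by simp
  qed
qed

section \<open>Volumes and half cells\<close>

lemma vol_fat_box:
  assumes "fat_box B"
  shows "vol B = (hi B i - lo B i) * (\<Prod>k\<in>UNIV - {i}. hi B k - lo B k)"
proof -
  have "cbox (interval_lowerbound B) (interval_upperbound B) \<noteq> {}"
    using fat_boxE(2)[OF assms] by (auto simp: interval_eq_empty_cart not_less less_imp_le)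
  then have "vol B = (\<Prod>k\<in>UNIV. hi B k - lo B k)"
    by (subst fat_boxE(1)[OF assms]) (rule content_cbox_cart)
  then show ?thesis by (simp add: prod.remove[of UNIV i])
qed

lemma vol_fat_box_pos:
  assumes "fat_box B"
  shows "vol B > 0"
  unfolding vol_fat_box[OF assms, of undefined]
  using fat_boxE(2)[OF assms] by (intro mult_pos_pos prod_pos) auto

lemma half_cell_face:
  assumes "fat_box K"
  shows "half_cell (face K i s) K = {x \<in> K. if s then mid K i \<le> x $ i else x $ i \<le> mid K i}"
  unfolding half_cell_def
proof (intro Collect_cong conj_cong refl)
  fix x assume "x \<in> K"
  then have "lo K i \<le> x $ i" "x $ i \<le> hi K i" by (simp_all add: mem_fat_box[OF assms])
  then show "\<bar>x $ dir (face K i s) - lo (face K i s) (dir (face K i s))\<bar>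
        \<le> (hi K (dir (face K i s)) - lo K (dir (face K i s))) / 2
      \<longleftrightarrow> (if s then mid K i \<le> x $ i else x $ i \<le> mid K i)"
    by (auto simp: dir_face[OF assms] lo_hi_face[OF assms] bound_def mid_def abs_if field_simps)
qed

lemma half_cell_cbox:
  assumes "fat_box K"
  shows "half_cell (face K i s) K =
    cbox (\<chi> k. if k = i \<and> s then mid K i else lo K k) (\<chi> k. if k = i \<and> \<not> s then mid K i else hi K k)"
proof (rule set_eqI)
  fix x
  have "x \<in> half_cell (face K i s) K \<longleftrightarrow>
      (\<forall>k. lo K k \<le> x $ k \<and> x $ k \<le> hi K k) \<and> (if s then mid K i \<le> x $ i else x $ i \<le> mid K i)"
    by (simp add: half_cell_face[OF assms] mem_fat_box[OF assms])
  also have "\<dots> \<longleftrightarrow> (\<forall>k. (if k = i \<and> s then mid K i else lo K k) \<le> x $ k \<and>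
      x $ k \<le> (if k = i \<and> \<not> s then mid K i else hi K k))" (is "?L \<longleftrightarrow> ?R")
  proof
    assume R: ?R
    have "lo K k \<le> x $ k \<and> x $ k \<le> hi K k" for k
      using R[rule_format, of k] mid_strict[OF assms, of i] by (auto split: if_splits)
    moreover have "if s then mid K i \<le> x $ i else x $ i \<le> mid K i"
      using R[rule_format, of i] by (auto split: if_splits)
    ultimately show ?L by blast
  qed auto
  finally show "x \<in> half_cell (face K i s) K \<longleftrightarrow> x \<in> cbox
      (\<chi> k. if k = i \<and> s then mid K i else lo K k) (\<chi> k. if k = i \<and> \<not> s then mid K i else hi K k)"
    by (simp add: mem_box_cart)
qed

lemma vol_half_cell:
  assumes "fat_box K"
  shows "vol (half_cell (face K i s) K) = vol K / 2"
proof -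
  let ?a = "\<chi> k. if k = i \<and> s then mid K i else lo K k"
  let ?b = "\<chi> k. if k = i \<and> \<not> s then mid K i else hi K k"
  have lt: "?a $ k < ?b $ k" for k
    using fat_boxE(2)[OF assms, of k] mid_strict[OF assms, of k] by auto
  have 1: "interval_lowerbound (cbox ?a ?b) = ?a" "interval_upperbound (cbox ?a ?b) = ?b"
    by (rule cbox_bounds; use lt in \<open>blast intro: less_imp_le\<close>)+
  have "vol (cbox ?a ?b) = (?b $ i - ?a $ i) * (\<Prod>k\<in>UNIV - {i}. ?b $ k - ?a $ k)"
    using vol_fat_box[OF fat_box_cbox[OF lt], of i] unfolding 1 .
  also have "(\<Prod>k\<in>UNIV - {i}. ?b $ k - ?a $ k) = (\<Prod>k\<in>UNIV - {i}. hi K k - lo K k)"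
    by (intro prod.cong) auto
  also have "?b $ i - ?a $ i = (hi K i - lo K i) / 2"
    by (auto simp: mid_def field_simps)
  finally show ?thesis
    by (simp add: half_cell_cbox[OF assms] vol_fat_box[OF assms, of i])
qed

section \<open>Combinatorics of a MAC grid\<close>

locale mac =
  fixes \<Omega> :: "(real ^ 'd::finite) set" and M :: "'d cell set"
  assumes grid: "mac_grid \<Omega> M"
begin

lemma card_ge_2: "CARD('d) \<ge> 2"
  using grid by (auto simp: mac_grid_def)

lemma finite_cells: "finite M"
  using grid by (auto simp: mac_grid_def)

lemma cells_cover: "\<Union>M = closure \<Omega>"
  using grid by (auto simp: mac_grid_def division_of_def)

lemma ext_edges_cover: "\<Union>(ext_edges \<Omega> M) = frontier \<Omega>"
  using grid by (simp add: mac_grid_def)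

lemma cell_fat:
  assumes "K \<in> M"
  shows "fat_box K"
proof -
  have div: "M division_of closure \<Omega>" and "interior K \<noteq> {}"
    using grid assms by (auto simp: mac_grid_def)
  moreover obtain a b where "K = cbox a b" using div assms by (rule division_ofD(4)[THEN exE]) blast
  ultimately show ?thesis
    by (auto simp: fat_box_def interval_eq_empty_cart not_le)
qed

text \<open>A line through the common point in direction \<open>j\<close> meets \<open>K\<close> in
  a segment with an inner point in \<open>L\<close>. As the intersection is a face of
  \<open>K\<close>, it must contain both end points of the segment.\<close>

lemma cells_extent_le:
  assumes "K \<in> M" "L \<in> M" "x \<in> K" "x \<in> L" "lo L j < hi K j" "lo K j < hi L j"
  shows "lo L j \<le> lo K j" "hi K j \<le> hi L j"
proof -
  have fK: "fat_box K" and fL: "fat_box L" using assms cell_fat by auto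
  have K: "lo K j < hi K j" and L: "lo L j < hi L j" using fK fL fat_boxE by auto
  \<comment> \<open>The midpoint of the overlap of the two extents lies strictly inside
    both.\<close>
  define m where "m = (max (lo K j) (lo L j) + min (hi K j) (hi L j)) / 2"
  have m: "lo K j < m" "m < hi K j" "lo L j < m" "m < hi L j"
    using K L assms(5,6) by (auto simp: m_def)
  define y where "y t = (\<chi> k. if k = j then t else x $ k)" for t
  have yK: "y t \<in> K" if "lo K j \<le> t" "t \<le> hi K j" for t
    using that assms(3) by (auto simp: mem_fat_box[OF fK] y_def)
  have yL: "y t \<in> L \<longleftrightarrow> lo L j \<le> t \<and> t \<le> hi L j" for t
    using assms(4) by (auto simp: mem_fat_box[OF fL] y_def)
  have "(K \<inter> L) face_of K" using grid assms by (auto simp: mac_grid_def)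
  moreover have "y m \<in> open_segment (y (lo K j)) (y (hi K j))"
    unfolding in_segment
  proof (intro conjI exI)
    show "y (lo K j) \<noteq> y (hi K j)" using K by (auto simp: y_def vec_eq_iff)
    define u where "u = (m - lo K j) / (hi K j - lo K j)"
    show "0 < u" "u < 1" using m K by (auto simp: u_def)
    have "u * (hi K j - lo K j) = m - lo K j" using K by (simp add: u_def)
    then show "y m = (1 - u) *\<^sub>R y (lo K j) + u *\<^sub>R y (hi K j)"
      by (simp add: y_def vec_eq_iff algebra_simps)
  qed
  ultimately have "y (lo K j) \<in> K \<inter> L \<and> y (hi K j) \<in> K \<inter> L"
    by (rule face_ofD) (use yK yL m K in auto)
  then show "lo L j \<le> lo K j" "hi K j \<le> hi L j" using yL by auto
qed

text \<open>This is the coordinate form of the face-to-face condition: in each direction, cells that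
  meet have equal extents or are stacked. Overlapping extents are compared in both orders by
  \<open>cells_extent_le\<close>.\<close>

lemma cells_meet_cases:
  assumes "K \<in> M" "L \<in> M" "x \<in> K" "x \<in> L"
  obtains "lo K j = lo L j" "hi K j = hi L j" | "hi K j = lo L j" "x $ j = hi K j"
    | "hi L j = lo K j" "x $ j = lo K j"
proof -
  have "lo K j \<le> x $ j" "x $ j \<le> hi K j" "lo L j \<le> x $ j" "x $ j \<le> hi L j"
    using assms by (auto simp: mem_fat_box[OF cell_fat])
  then consider "hi K j = lo L j" "x $ j = hi K j" | "hi L j = lo K j" "x $ j = lo K j"
    | "lo L j < hi K j" "lo K j < hi L j"
    by linarith
  then show thesis
  proof cases
    case 3
    then show thesis
      using cells_extent_le[OF assms 3] cells_extent_le[OF assms(2,1,4,3) 3(2,1)] that(1) by simp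
  qed (rule that(2,3); assumption)+
qed

lemma cells_meet_strict:
  assumes "K \<in> M" "Q \<in> M" "x \<in> K" "x \<in> Q" "lo K k < x $ k" "x $ k < hi K k"
  shows "lo Q k = lo K k" "hi Q k = hi K k"
  by (rule cells_meet_cases[OF assms(1-4), of k]; use assms(5,6) in simp)+

lemma cells_meet_same_bound:
  assumes "K \<in> M" "L \<in> M" "x \<in> K" "x \<in> L" "bound K i s = bound L i s"
  shows "lo L i = lo K i" "hi L i = hi K i"
  by (rule cells_meet_cases[OF assms(1-4), of i];
      use assms(5) fat_boxE(2)[OF cell_fat[OF assms(1)], of i] fat_boxE(2)[OF cell_fat[OF assms(2)], of i]
      in \<open>simp add: bound_def split: if_splits\<close>)+

text \<open>An oriented form of the edge \<open>K|L\<close>, the common face being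
  \<open>face K i s\<close>. It also holds across a slit, where that face is external, so being
  internal remains a separate hypothesis.\<close>

definition nb :: "'d cell \<Rightarrow> 'd \<Rightarrow> bool \<Rightarrow> 'd cell \<Rightarrow> bool" where
  "nb K i s L \<longleftrightarrow> K \<in> M \<and> L \<in> M \<and> bound L i (\<not> s) = bound K i s \<and>
     (\<forall>k. k \<noteq> i \<longrightarrow> lo L k = lo K k \<and> hi L k = hi K k)"

lemma nbD:
  assumes "nb K i s L"
  shows "K \<in> M" "L \<in> M" "fat_box K" "fat_box L" "bound L i (\<not> s) = bound K i s"
    "k \<noteq> i \<Longrightarrow> lo L k = lo K k" "k \<noteq> i \<Longrightarrow> hi L k = hi K k"
  using assms by (auto simp: nb_def cell_fat)

lemma nb_sym: "nb K i s L \<Longrightarrow> nb L i (\<not> s) K"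
  by (auto simp: nb_def)

lemma nb_face:
  assumes "nb K i s L"
  shows "face L i (\<not> s) = face K i s"
  unfolding face_eq_cbox[OF nbD(3)[OF assms]] face_eq_cbox[OF nbD(4)[OF assms]]
  using nbD(5-7)[OF assms] by (auto intro!: arg_cong2[where f = cbox] simp: vec_eq_iff)

lemma nb_neq: "nb K i s L \<Longrightarrow> L \<noteq> K"
  using nbD(3)[of K i s L] fat_boxE(2)[of K i] by (auto simp: nb_def bound_def split: if_splits)

lemma face_nonempty:
  assumes "fat_box K"
  obtains x where "x \<in> face K i s"
proof
  show "(\<chi> k. if k = i then bound K i s else lo K k) \<in> face K i s"
    using bound_bounds[OF assms] fat_boxE(2)[OF assms]
    by (auto simp: face_def mem_fat_box[OF assms] less_imp_le)
qed

lemma nb_unique: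
  assumes "nb K i s L" "nb K i s L'"
  shows "L' = L"
proof -
  obtain x where "x \<in> face K i s" using face_nonempty[OF nbD(3)[OF assms(1)]] .
  then have x: "x \<in> L" "x \<in> L'"
    using nb_face[OF assms(1)] nb_face[OF assms(2)] face_subset by blast+
  have "bound L i (\<not> s) = bound L' i (\<not> s)" using nbD(5) assms by metis
  note * = cells_meet_same_bound[OF nbD(2)[OF assms(1)] nbD(2)[OF assms(2)] x this]
  show ?thesis
    using * nbD(6,7)[OF assms(1)] nbD(6,7)[OF assms(2)]
    by (intro fat_box_eqI nbD(4)[OF assms(1)] nbD(4)[OF assms(2)]) metis+
qed

text \<open>Two cells on the same side of a common face would have the same extent in the normal
  direction by \<open>cells_meet_same_bound\<close>, and the face fixes all other extents, so they
  would coincide.\<close>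

lemma shared_face:
  assumes "K \<in> M" "L \<in> M" "L \<noteq> K" "face K i s = face L j t"
  shows "j = i" "t = (\<not> s)" "nb K i s L"
proof -
  have fK: "fat_box K" and fL: "fat_box L" using assms cell_fat by auto
  show ij: "j = i" using assms(4) dir_face fK fL by metis
  have lo: "lo L k = lo K k" and hi: "hi L k = hi K k" if "k \<noteq> i" for k
    using that lo_hi_face[OF fK, of i s k] lo_hi_face[OF fL, of i t k] assms(4) ij by auto
  have bd: "bound L i t = bound K i s"
    using lo_hi_face[OF fK, of i s i] lo_hi_face[OF fL, of i t i] assms(4) ij by auto
  show t: "t = (\<not> s)"
  proof (rule ccontr)
    assume "t \<noteq> (\<not> s)"
    then have bd: "bound K i s = bound L i s" using bd by simp
    obtain x where "x \<in> face K i s" using face_nonempty[OF fK] .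
    then have x: "x \<in> K" "x \<in> L" using assms(4) face_subset by blast+
    have "L = K"
      using cells_meet_same_bound[OF assms(1,2) x bd] lo hi by (intro fat_box_eqI fK fL) metis+
    then show False using assms(3) by simp
  qed
  show "nb K i s L" using assms lo hi bd t by (auto simp: nb_def)
qed

lemma cells_of_face:
  assumes "nb K i s L"
  shows "{Q \<in> M. face K i s \<in> box_edges Q} = {K, L}"
proof (intro equalityI subsetI)
  fix Q assume "Q \<in> {Q \<in> M. face K i s \<in> box_edges Q}"
  then obtain j t where Q: "Q \<in> M" "face K i s = face Q j t" by (auto elim: box_edgesE)
  then show "Q \<in> {K, L}"
    using shared_face[OF nbD(1)[OF assms] Q(1) _ Q(2)] nb_unique[OF assms] by blast
next
  fix Q assume "Q \<in> {K, L}"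
  then show "Q \<in> {Q \<in> M. face K i s \<in> box_edges Q}"
    using nbD(1,2)[OF assms] nb_face[OF assms] face_in_box_edges[of K i s]
      face_in_box_edges[of L i "\<not> s"] by fastforce
qed

lemma cells_of_single_face:
  assumes "K \<in> M" "\<nexists>L. nb K i s L"
  shows "{Q \<in> M. face K i s \<in> box_edges Q} = {K}"
proof (intro equalityI subsetI)
  fix Q assume "Q \<in> {Q \<in> M. face K i s \<in> box_edges Q}"
  then obtain j t where Q: "Q \<in> M" "face K i s = face Q j t" by (auto elim: box_edgesE)
  then show "Q \<in> {K}" using shared_face(3)[OF assms(1) Q(1) _ Q(2)] assms(2) by blast
qed (use assms(1) in auto)

lemma opposite_eq:
  assumes "nb K i s L"
  shows "opposite M (face K i s) K = L"
  unfolding opposite_def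
  by (rule the_equality) (use cells_of_face[OF assms] nb_neq[OF assms] in blast)+

lemma cell_before_eq:
  assumes "nb K i s L"
  shows "cell_before M (face K i s) = (if s then K else L)"
proof -
  have *: "cell_before M (face K i True) = K" if nb: "nb K i True L" for K L
    unfolding cell_before_def
  proof (rule the_equality)
    show "K \<in> M \<and> face K i True \<in> box_edges K \<and>
        lo (face K i True) (dir (face K i True)) = hi K (dir (face K i True))"
      using nbD[OF nb] by (simp add: dir_face lo_hi_face bound_def)
  next
    fix Q assume Q: "Q \<in> M \<and> face K i True \<in> box_edges Q \<and>
        lo (face K i True) (dir (face K i True)) = hi Q (dir (face K i True))"
    then have "Q = K \<or> Q = L" using cells_of_face[OF nb] by auto
    moreover have "hi Q i = bound K i True"
      using Q nbD[OF nb] by (simp add: dir_face lo_hi_face)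
    moreover have "bound K i True = lo L i" using nbD(5)[OF nb] by (simp add: bound_def)
    ultimately show "Q = K" using fat_boxE(2)[OF nbD(4)[OF nb], of i] by auto
  qed
  show ?thesis
  proof (cases s)
    case True
    then show ?thesis using *[of K L] assms by simp
  next
    case False
    then show ?thesis using *[of L K] nb_sym[OF assms] nb_face[OF assms] by simp
  qed
qed

text \<open>From a point of the face inside the open domain, one first moves into the relative
  interior of the face and then steps out of \<open>K\<close> across it. The cell reached there is
  the neighbour.\<close>

lemma nb_exists:
  assumes K: "K \<in> M" and int: "\<not> face K i s \<subseteq> frontier \<Omega>"
  obtains L where "nb K i s L"
proof -
  note fK = cell_fat[OF K]
  have op: "open \<Omega>" using grid by (simp add: mac_grid_def)
  obtain x where xf: "x \<in> face K i s" and "x \<notin> frontier \<Omega>" using int by blast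
  moreover have "x \<in> closure \<Omega>" using xf face_subset K cells_cover by blast
  ultimately have x\<Omega>: "x \<in> \<Omega>" using op by (simp add: frontier_def interior_open)
  then obtain r where r: "r > 0" "ball x r \<subseteq> \<Omega>" using op open_contains_ball by blast
  define c where "c = (\<chi> k. if k = i then bound K i s else mid K k)"
  \<comment> \<open>A fraction of the way to the face centre \<open>c\<close> that stays within
    distance \<open>r\<close>; the summand \<open>2 * r\<close> keeps \<open>t\<close> below 1 even
    if \<open>x = c\<close>.\<close>
  define t where "t = r / (norm (c - x) + 2 * r)"
  have den: "norm (c - x) + 2 * r > 0" using r(1) norm_ge_zero[of "c - x"] by linarith
  have t: "0 < t" "t < 1" unfolding t_def using r(1) den by (auto simp: add_pos_nonneg)
  define x' where "x' = x + t *\<^sub>R (c - x)"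
  have "t * norm (c - x) < r"
  proof -
    have "t * norm (c - x) = r * (norm (c - x) / (norm (c - x) + 2 * r))" by (simp add: t_def)
    also have "\<dots> < r * 1" using r(1) den by (intro mult_strict_left_mono) auto
    finally show ?thesis by simp
  qed
  then have "dist x x' < r" using t(1) by (simp add: x'_def dist_norm)
  then have x'\<Omega>: "x' \<in> \<Omega>" using r(2) by auto
  have xK: "lo K k \<le> x $ k" "x $ k \<le> hi K k" for k
    using xf face_subset[of K i s] by (auto simp: mem_fat_box[OF fK])
  have x'i: "x' $ i = bound K i s" using xf by (simp add: x'_def c_def face_def)
  have x'k: "lo K k < x' $ k \<and> x' $ k < hi K k" if "k \<noteq> i" for k
  proof -
    have eq: "x' $ k = (1 - t) * x $ k + t * mid K k"
      using that by (simp add: x'_def c_def algebra_simps)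
    have "(1 - t) * lo K k + t * lo K k < (1 - t) * x $ k + t * mid K k"
      using t xK mid_strict(1)[OF fK, of k] by (intro add_le_less_mono mult_left_mono mult_strict_left_mono) auto
    moreover have "(1 - t) * x $ k + t * mid K k < (1 - t) * hi K k + t * hi K k"
      using t xK mid_strict(2)[OF fK, of k] by (intro add_le_less_mono mult_left_mono mult_strict_left_mono) auto
    ultimately show ?thesis unfolding eq by (simp add: algebra_simps)
  qed
  have x'K: "x' \<in> K"
    unfolding mem_fat_box[OF fK]
  proof
    fix k show "lo K k \<le> x' $ k \<and> x' $ k \<le> hi K k"
      using x'k[of k] x'i bound_bounds[OF fK, of i s] by (cases "k = i") auto
  qed
  \<comment> \<open>Finitely many closed cells are removed, so \<open>V\<close> is an open
    neighbourhood of \<open>x'\<close> in which every cell that occurs contains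
    \<open>x'\<close>.\<close>
  define V where "V = \<Omega> - \<Union>{Q \<in> M. x' \<notin> Q}"
  have "closed (\<Union>{Q \<in> M. x' \<notin> Q})"
    using finite_cells by (intro closed_Union) (auto dest!: cell_fat simp: fat_box_def)
  then have "open V" unfolding V_def using op by (rule open_Diff[rotated])
  moreover have "x' \<in> V" using x'\<Omega> by (auto simp: V_def)
  ultimately obtain q where q: "q > 0" "ball x' q \<subseteq> V" using open_contains_ball by blast
  \<comment> \<open>A short step across the face. Of the possible positions of a cell meeting
    \<open>K\<close>, only the one beyond side \<open>s\<close> contains \<open>y\<close>.\<close>
  define y where "y = x' + (if s then q / 2 else - (q / 2)) *\<^sub>R axis i 1"
  have "dist x' y < q" using q(1) by (simp add: y_def dist_norm)
  then have yV: "y \<in> V" using q(2) by auto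
  then have "y \<in> closure \<Omega>" using closure_subset by (auto simp: V_def)
  then obtain L where L: "L \<in> M" "y \<in> L" using cells_cover by blast
  have x'L: "x' \<in> L" using yV L by (auto simp: V_def)
  note fL = cell_fat[OF L(1)]
  have other: "lo L k = lo K k \<and> hi L k = hi K k" if "k \<noteq> i" for k
    using cells_meet_strict[OF K L(1) x'K x'L] x'k[OF that] by blast
  have yi: "y $ i = bound K i s + (if s then q / 2 else - (q / 2))"
    by (simp add: y_def x'i)
  have yL: "lo L i \<le> y $ i" "y $ i \<le> hi L i" using L(2) by (auto simp: mem_fat_box[OF fL])
  have "bound L i (\<not> s) = bound K i s"
  proof (rule cells_meet_cases[OF K L(1) x'K x'L, of i])
  qed (use yi yL q(1) x'i fat_boxE(2)[OF fK, of i] fat_boxE(2)[OF fL, of i] in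
      \<open>auto simp: bound_def split: if_splits\<close>)
  then have "nb K i s L" using K L other by (auto simp: nb_def)
  then show thesis by (rule that)
qed

lemma face_in_edges: "K \<in> M \<Longrightarrow> face K i s \<in> edges M"
  unfolding edges_def using face_in_box_edges by blast

lemma face_int_edges_iff:
  assumes "K \<in> M"
  shows "face K i s \<in> int_edges \<Omega> M \<longleftrightarrow> \<not> face K i s \<subseteq> frontier \<Omega>"
  using face_in_edges[OF assms] by (simp add: int_edges_def)

lemma int_edges_nbE:
  assumes "\<sigma> \<in> int_edges \<Omega> M"
  obtains K L where "nb K (dir \<sigma>) True L" "\<sigma> = face K (dir \<sigma>) True"
proof -
  obtain K where K: "K \<in> M" "\<sigma> \<in> box_edges K" and nf: "\<not> \<sigma> \<subseteq> frontier \<Omega>"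
    using assms by (auto simp: int_edges_def edges_def)
  obtain i s where \<sigma>: "\<sigma> = face K i s" using K(2) by (rule box_edgesE)
  obtain L where L: "nb K i s L" using nb_exists[OF K(1)] nf \<sigma> by blast
  have i: "dir \<sigma> = i" using \<sigma> dir_face[OF cell_fat[OF K(1)]] by simp
  show thesis
  proof (cases s)
    case True
    then show thesis using that L \<sigma> i by simp
  next
    case False
    then show thesis using that[of L K] nb_sym[OF L] nb_face[OF L] \<sigma> i by simp
  qed
qed

lemma finite_edges: "finite (edges M)"
  using finite_cells by (simp add: edges_def)

lemma finite_int_edges: "finite (int_edges \<Omega> M)"
  using finite_edges by (simp add: int_edges_def)

text \<open>The dual cell as an explicit box between the two cell midplanes; \<open>min\<close> and
  \<open>max\<close> make it independent of which cell comes first.\<close>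

definition dual_box :: "'d cell \<Rightarrow> 'd \<Rightarrow> 'd cell \<Rightarrow> (real ^ 'd) set" where
  "dual_box K i L = cbox (\<chi> k. if k = i then min (mid K i) (mid L i) else lo K k)
                         (\<chi> k. if k = i then max (mid K i) (mid L i) else hi K k)"

lemma nb_mid:
  assumes "nb K i s L"
  shows "if s then mid K i < bound K i s \<and> bound K i s < mid L i
         else mid L i < bound K i s \<and> bound K i s < mid K i"
  using mid_strict[OF nbD(3)[OF assms], of i] mid_strict[OF nbD(4)[OF assms], of i]
    nbD(5)[OF assms] by (auto simp: bound_def split: if_splits)

lemma dual_box_strict:
  assumes "nb K i s L"
  shows "(\<chi> k. if k = i then min (mid K i) (mid L i) else lo K k) $ k
      < (\<chi> k. if k = i then max (mid K i) (mid L i) else hi K k) $ k"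
  using nb_mid[OF assms] fat_boxE(2)[OF nbD(3)[OF assms], of k] by (auto split: if_splits)

lemma fat_dual_box: "nb K i s L \<Longrightarrow> fat_box (dual_box K i L)"
  unfolding dual_box_def by (rule fat_box_cbox) (rule dual_box_strict)

lemma lo_hi_dual_box:
  assumes "nb K i s L"
  shows "lo (dual_box K i L) k = (if k = i then min (mid K i) (mid L i) else lo K k)"
    "hi (dual_box K i L) k = (if k = i then max (mid K i) (mid L i) else hi K k)"
  unfolding dual_box_def using cbox_bounds[OF less_imp_le[OF dual_box_strict[OF assms]]]
  by simp_all

lemma dual_box_sym: "nb K i s L \<Longrightarrow> dual_box L i K = dual_box K i L"
  by (intro fat_box_eqI fat_dual_box[of K i s L] fat_dual_box[of L i "\<not> s" K])
     (auto simp: lo_hi_dual_box[of K i s L] lo_hi_dual_box[of L i "\<not> s" K] nb_sym nbD min.commute max.commute)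

lemma dual_cell_eq:
  assumes "nb K i s L"
  shows "dual_cell M (face K i s) = dual_box K i L"
proof -
  have *: "half_cell (face K i True) K \<union> half_cell (face L i False) L = dual_box K i L"
    if nb: "nb K i True L" for K L
  proof (rule set_eqI)
    fix x
    have KL: "bound L i False = bound K i True" "\<And>k. k \<noteq> i \<Longrightarrow> lo L k = lo K k"
      "\<And>k. k \<noteq> i \<Longrightarrow> hi L k = hi K k" using nbD[OF nb] by auto
    have m: "mid K i < hi K i" "lo L i < mid L i" "lo K i < mid K i" "mid L i < hi L i"
      using mid_strict nbD(3,4)[OF nb] by auto
    have b: "hi K i = lo L i" using KL(1) by (simp add: bound_def)
    have split: "(\<forall>k. P k) \<longleftrightarrow> P i \<and> (\<forall>k. k \<noteq> i \<longrightarrow> P k)" for P :: "'d \<Rightarrow> bool" by metis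
    have "x \<in> half_cell (face K i True) K \<longleftrightarrow> mid K i \<le> x $ i \<and> x $ i \<le> hi K i \<and>
        (\<forall>k. k \<noteq> i \<longrightarrow> lo K k \<le> x $ k \<and> x $ k \<le> hi K k)"
      unfolding half_cell_face[OF nbD(3)[OF nb]] using m
      by (subst mem_Collect_eq, subst mem_fat_box[OF nbD(3)[OF nb]], subst split) auto
    moreover have "x \<in> half_cell (face L i False) L \<longleftrightarrow> lo L i \<le> x $ i \<and> x $ i \<le> mid L i \<and>
        (\<forall>k. k \<noteq> i \<longrightarrow> lo K k \<le> x $ k \<and> x $ k \<le> hi K k)"
      unfolding half_cell_face[OF nbD(4)[OF nb]] using m KL
      by (subst mem_Collect_eq, subst mem_fat_box[OF nbD(4)[OF nb]], subst split) auto
    moreover have "x \<in> dual_box K i L \<longleftrightarrow> mid K i \<le> x $ i \<and> x $ i \<le> mid L i \<and>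
        (\<forall>k. k \<noteq> i \<longrightarrow> lo K k \<le> x $ k \<and> x $ k \<le> hi K k)"
      unfolding mem_fat_box[OF fat_dual_box[OF nb]] lo_hi_dual_box[OF nb] using m b
      by (subst split) auto
    ultimately show "x \<in> half_cell (face K i True) K \<union> half_cell (face L i False) L
        \<longleftrightarrow> x \<in> dual_box K i L"
      using m b by auto
  qed
  have "dual_cell M (face K i s) = half_cell (face K i s) K \<union> half_cell (face K i s) L"
    unfolding dual_cell_def cells_of_face[OF assms] by auto
  also have "\<dots> = half_cell (face K i s) K \<union> half_cell (face L i (\<not> s)) L"
    by (simp add: nb_face[OF assms])
  also have "\<dots> = dual_box K i L"
    using *[of K L] *[of L K] assms nb_sym[OF assms] dual_box_sym[OF assms] by (cases s) auto
  finally show ?thesis .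
qed

lemma half_cell_subset_dual_cell:
  "K \<in> M \<Longrightarrow> half_cell (face K i s) K \<subseteq> dual_cell M (face K i s)"
  by (auto simp: dual_cell_def)

lemma mem_dual_cellE:
  assumes "x \<in> dual_cell M \<sigma>"
  obtains Q i s where "Q \<in> M" "\<sigma> = face Q i s" "x \<in> half_cell \<sigma> Q"
  using assms by (auto simp: dual_cell_def elim: box_edgesE)

text \<open>External edges are included, their dual cell being one half cell, because a dual
  neighbour may be external.\<close>

lemma dual_cell_is_cbox:
  assumes "\<sigma> \<in> edges M"
  obtains a b where "dual_cell M \<sigma> = cbox a b"
proof -
  obtain K i s where K: "K \<in> M" "\<sigma> = face K i s"
    using assms by (auto simp: edges_def elim: box_edgesE)
  show thesis
  proof (cases "\<exists>L. nb K i s L")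
    case True
    then show thesis using that dual_cell_eq K(2) by (auto simp: dual_box_def)
  next
    case False
    then have "dual_cell M \<sigma> = half_cell \<sigma> K"
      using cells_of_single_face[OF K(1)] K(2) by (simp add: dual_cell_def)
    then show thesis using that half_cell_cbox[OF cell_fat[OF K(1)]] K(2) by simp
  qed
qed

lemma vol_dual_cell:
  assumes "nb K i s L"
  shows "vol (dual_cell M (face K i s)) = vol K / 2 + vol L / 2"
proof -
  let ?p = "\<Prod>k\<in>UNIV - {i}. hi K k - lo K k"
  have "vol (dual_box K i L) = (max (mid K i) (mid L i) - min (mid K i) (mid L i)) * ?p"
    by (subst vol_fat_box[OF fat_dual_box[OF assms], of i])
       (auto simp: lo_hi_dual_box[OF assms] intro!: prod.cong)
  moreover have "(\<Prod>k\<in>UNIV - {i}. hi L k - lo L k) = ?p"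
    using nbD(6,7)[OF assms] by (intro prod.cong) auto
  moreover have "max (mid K i) (mid L i) - min (mid K i) (mid L i)
      = (hi K i - lo K i) / 2 + (hi L i - lo L i) / 2"
    using nb_mid[OF assms] nbD(5)[OF assms]
    by (auto simp: bound_def mid_def max_def min_def field_simps split: if_splits)
  ultimately show ?thesis
    unfolding dual_cell_eq[OF assms]
    by (simp add: vol_fat_box[OF nbD(3)[OF assms], of i] vol_fat_box[OF nbD(4)[OF assms], of i]
        algebra_simps)
qed

lemma strict_unique:
  assumes "K \<in> M" "Q \<in> M" "x \<in> Q" "\<And>k. lo K k < x $ k" "\<And>k. x $ k < hi K k"
  shows "Q = K"
proof -
  have "x \<in> K" using assms(4,5) by (simp add: mem_fat_box[OF cell_fat[OF assms(1)]] less_imp_le)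
  then show ?thesis
    using cells_meet_strict[OF assms(1,2) _ assms(3)] assms(4,5)
    by (intro fat_box_eqI cell_fat assms(1,2)) auto
qed

text \<open>The mesh resolves the boundary, so an external edge passes through \<open>x\<close>. Its
  cell has the extents of \<open>K\<close> in all directions other than \<open>j\<close>, where
  \<open>x\<close> is strictly inside, so this edge can only be the whole given face.\<close>

lemma face_subset_frontier:
  assumes K: "K \<in> M" and x: "x \<in> face K j t" "x \<in> frontier \<Omega>"
    and strict: "\<And>k. k \<noteq> j \<Longrightarrow> lo K k < x $ k \<and> x $ k < hi K k"
  shows "face K j t \<subseteq> frontier \<Omega>"
proof -
  note fK = cell_fat[OF K]
  obtain \<zeta> where \<zeta>: "\<zeta> \<in> ext_edges \<Omega> M" "x \<in> \<zeta>" using x(2) ext_edges_cover by blast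
  then obtain Q where Q: "Q \<in> M" "\<zeta> \<in> box_edges Q" by (auto simp: ext_edges_def edges_def)
  obtain m r where \<zeta>_eq: "\<zeta> = face Q m r" using Q(2) by (rule box_edgesE)
  note fQ = cell_fat[OF Q(1)]
  have xK: "x \<in> K" and xQ: "x \<in> Q" and xm: "x $ m = bound Q m r" and xj: "x $ j = bound K j t"
    using x \<zeta> \<zeta>_eq by (auto simp: face_def)
  have eq: "lo Q k = lo K k" "hi Q k = hi K k" if "k \<noteq> j" for k
    using cells_meet_strict[OF K Q(1) xK xQ] strict[OF that] by auto
  have "m = j"
  proof (rule ccontr)
    assume "m \<noteq> j"
    then show False using eq[of m] strict[of m] xm by (auto simp: bound_def split: if_splits)
  qed
  then have "face Q j r = face K j t"
    unfolding face_eq_cbox[OF fQ] face_eq_cbox[OF fK]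
    using xm xj eq by (auto intro!: arg_cong2[where f = cbox] simp: vec_eq_iff)
  then show ?thesis using \<zeta>(1) \<zeta>_eq \<open>m = j\<close> by (auto simp: ext_edges_def)
qed

section \<open>Edges of dual cells and the primal cells and faces that carry them\<close>

lemma half_cell_subset: "half_cell \<sigma> K \<subseteq> K"
  by (auto simp: half_cell_def)

lemma half_cell_strict:
  assumes "K \<in> M"
  shows "(\<chi> k. if k = i \<and> s then mid K i else lo K k) $ k < (\<chi> k. if k = i \<and> \<not> s then mid K i else hi K k) $ k"
  using fat_boxE(2)[OF cell_fat[OF assms], of k] mid_strict[OF cell_fat[OF assms], of k] by auto

lemma fat_half_cell:
  assumes "K \<in> M"
  shows "fat_box (half_cell (face K i s) K)"
  unfolding half_cell_cbox[OF cell_fat[OF assms]] by (rule fat_box_cbox) (rule half_cell_strict[OF assms])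

lemma lo_hi_half_cell:
  assumes "K \<in> M"
  shows "lo (half_cell (face K i s) K) k = (if k = i \<and> s then mid K i else lo K k)"
    "hi (half_cell (face K i s) K) k = (if k = i \<and> \<not> s then mid K i else hi K k)"
  unfolding half_cell_cbox[OF cell_fat[OF assms]]
  using cbox_bounds[OF less_imp_le[OF half_cell_strict[OF assms]]] by simp_all

lemma bound_half_cell:
  "K \<in> M \<Longrightarrow> j \<noteq> i \<Longrightarrow> bound (half_cell (face K i s) K) j t = bound K j t"
  by (simp add: bound_def lo_hi_half_cell)

lemma bound_dual_box:
  "nb K i s L \<Longrightarrow> j \<noteq> i \<Longrightarrow> bound (dual_box K i L) j t = bound K j t"
  by (simp add: bound_def lo_hi_dual_box)

lemma half_cell_subset_dual_box:
  "nb K i s L \<Longrightarrow> half_cell (face K i s) K \<subseteq> dual_box K i L"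
  using half_cell_subset_dual_cell[of K i s] nbD(1)[of K i s L] dual_cell_eq[of K i s L] by simp

lemma half_face_subset:
  assumes "nb K i s L" "j \<noteq> i"
  shows "face (half_cell (face K i s) K) j t \<subseteq> face (dual_box K i L) j t \<inter> face K j t"
  using half_cell_subset_dual_box[OF assms(1)] half_cell_subset[of "face K i s" K]
  by (auto simp: mem_face bound_half_cell[OF nbD(1)[OF assms(1)] assms(2)] bound_dual_box[OF assms])

lemma tangential_face_Int:
  assumes "nb K i s L" "j \<noteq> i"
  shows "face (dual_box K i L) j t \<inter> K \<subseteq> face K j t"
  by (auto simp: face_def bound_dual_box[OF assms])

text \<open>The part of the dual edge in \<open>K\<close> contains half of a face, which extends in
  every direction other than \<open>j\<close> and so fits into no face orthogonal to another
  direction.\<close>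

lemma tangential_face_unique:
  assumes nb: "nb K i s L" and ji: "j \<noteq> i"
  shows "(THE \<tau>. \<tau> \<in> box_edges K \<and> face (dual_box K i L) j t \<inter> K \<subseteq> \<tau>) = face K j t"
proof (rule the_equality)
  show "face K j t \<in> box_edges K \<and> face (dual_box K i L) j t \<inter> K \<subseteq> face K j t"
    using tangential_face_Int[OF assms] by simp
next
  fix \<tau> assume \<tau>: "\<tau> \<in> box_edges K \<and> face (dual_box K i L) j t \<inter> K \<subseteq> \<tau>"
  then obtain m r where m: "\<tau> = face K m r" by (auto elim: box_edgesE)
  let ?H = "half_cell (face K i s) K"
  note KM = nbD(1)[OF nb] and fK = nbD(3)[OF nb]
  note fH = fat_half_cell[OF KM, of i s]
  have sub: "face ?H j t \<subseteq> face K m r"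
    using half_face_subset[OF assms, of t] \<tau> m face_subset[of K j t] by blast
  have "m = j"
  proof (rule ccontr)
    assume "m \<noteq> j"
    have "\<not> face ?H j t \<subseteq> face K m r"
      unfolding face_eq_cbox[OF fH]
      by (rule cbox_not_subset_face[OF fK])
         (use \<open>m \<noteq> j\<close> fat_boxE(2)[OF fH] in \<open>auto simp: less_imp_le\<close>)
    then show False using sub by simp
  qed
  moreover obtain x where "x \<in> face ?H j t" using face_nonempty[OF fH] .
  then have "bound K j t = bound K j r"
    using sub half_face_subset[OF assms, of t] \<open>m = j\<close> by (auto simp: mem_face subset_iff)
  then have "r = t"
    using fat_boxE(2)[OF fK, of j] by (auto simp: bound_def split: if_splits)
  ultimately show "\<tau> = face K j t" using m by simp
qed

text \<open>Needed because \<open>dual_flux\<close> is zero by definition on boundary dual edges: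
  the two primal fluxes in the general formula then vanish too.\<close>

lemma tangential_face_frontier:
  assumes nb: "nb K i s L" and ji: "j \<noteq> i" and sub: "face (dual_box K i L) j t \<subseteq> frontier \<Omega>"
  shows "face K j t \<subseteq> frontier \<Omega>"
proof -
  let ?H = "half_cell (face K i s) K"
  note KM = nbD(1)[OF nb]
  note fH = fat_half_cell[OF KM, of i s]
  \<comment> \<open>The centre of the half face; it avoids the boundary of \<open>K\<close> in
    direction \<open>i\<close> because it sits in the middle of the half cell.\<close>
  define x where "x = (\<chi> k. if k = j then bound ?H j t else mid ?H k)"
  have xH: "x \<in> face ?H j t"
    using bound_bounds[OF fH, of j t] mid_strict[OF fH]
    by (auto simp: mem_face mem_fat_box[OF fH] x_def less_imp_le)
  show ?thesis
  proof (rule face_subset_frontier[OF KM])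
    show "x \<in> face K j t" "x \<in> frontier \<Omega>" using xH half_face_subset[OF nb ji] sub by blast+
    fix k assume "k \<noteq> j"
    then have "lo ?H k < x $ k" "x $ k < hi ?H k" using mid_strict[OF fH, of k] by (auto simp: x_def)
    then show "lo K k < x $ k \<and> x $ k < hi K k"
      using mid_strict[OF nbD(3)[OF nb], of i]
      by (auto simp: lo_hi_half_cell[OF KM] split: if_splits)
  qed
qed

lemma middle_face_eq:
  assumes "nb K i s L"
  shows "face (dual_box K i L) i (\<not> s) = {x \<in> K. x $ i = mid K i}"
proof -
  have b: "bound (dual_box K i L) i (\<not> s) = mid K i"
    using nb_mid[OF assms] by (auto simp: bound_def lo_hi_dual_box[OF assms] split: if_splits)
  have "x \<in> dual_box K i L \<longleftrightarrow> x \<in> K" if x: "x $ i = mid K i" for x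
  proof -
    have split: "(\<forall>k. P k) \<longleftrightarrow> P i \<and> (\<forall>k. k \<noteq> i \<longrightarrow> P k)" for P :: "'d \<Rightarrow> bool" by metis
    have "x \<in> dual_box K i L \<longleftrightarrow> (\<forall>k. k \<noteq> i \<longrightarrow> lo K k \<le> x $ k \<and> x $ k \<le> hi K k)"
      unfolding mem_fat_box[OF fat_dual_box[OF assms]] lo_hi_dual_box[OF assms] using x
      by (subst split) auto
    moreover have "x \<in> K \<longleftrightarrow> (\<forall>k. k \<noteq> i \<longrightarrow> lo K k \<le> x $ k \<and> x $ k \<le> hi K k)"
      unfolding mem_fat_box[OF nbD(3)[OF assms]] using x mid_strict[OF nbD(3)[OF assms], of i]
      by (subst split) auto
    ultimately show ?thesis by simp
  qed
  then show ?thesis unfolding face_def b by auto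
qed

lemma middle_face_strict:
  assumes "nb K i s L"
  obtains x where "x \<in> face (dual_box K i L) i (\<not> s)" "\<And>k. lo K k < x $ k" "\<And>k. x $ k < hi K k"
proof
  show "(\<chi> k. mid K k) \<in> face (dual_box K i L) i (\<not> s)"
    unfolding middle_face_eq[OF assms] using mid_strict[OF nbD(3)[OF assms]]
    by (auto simp: mem_fat_box[OF nbD(3)[OF assms]] less_imp_le)
qed (use mid_strict[OF nbD(3)[OF assms]] in auto)

text \<open>The centre of \<open>K\<close> belongs to no other cell and to no face of
  \<open>K\<close>, while every boundary point lies on a face of some cell.\<close>

lemma middle_face_not_frontier:
  assumes "nb K i s L"
  shows "\<not> face (dual_box K i L) i (\<not> s) \<subseteq> frontier \<Omega>"
proof
  assume sub: "face (dual_box K i L) i (\<not> s) \<subseteq> frontier \<Omega>"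
  obtain x where x: "x \<in> face (dual_box K i L) i (\<not> s)" "\<And>k. lo K k < x $ k" "\<And>k. x $ k < hi K k"
    using middle_face_strict[OF assms] by blast
  obtain \<zeta> where \<zeta>: "\<zeta> \<in> ext_edges \<Omega> M" "x \<in> \<zeta>" using x(1) sub ext_edges_cover by blast
  then obtain Q m r where Q: "Q \<in> M" "\<zeta> = face Q m r"
    by (auto simp: ext_edges_def edges_def elim: box_edgesE)
  have "Q = K"
    using strict_unique[OF nbD(1)[OF assms] Q(1) _ x(2,3)] \<zeta>(2) Q(2) by (auto simp: face_def)
  then show False using \<zeta>(2) Q(2) x(2,3)[of m] by (auto simp: face_def bound_def split: if_splits)
qed

lemma middle_face_cell:
  assumes "nb K i s L"
  shows "(THE Q. Q \<in> M \<and> face (dual_box K i L) i (\<not> s) \<subseteq> Q) = K"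
proof (rule the_equality)
  show "K \<in> M \<and> face (dual_box K i L) i (\<not> s) \<subseteq> K"
    using nbD(1)[OF assms] middle_face_eq[OF assms] by auto
next
  fix Q assume Q: "Q \<in> M \<and> face (dual_box K i L) i (\<not> s) \<subseteq> Q"
  obtain x where x: "x \<in> face (dual_box K i L) i (\<not> s)" "\<And>k. lo K k < x $ k" "\<And>k. x $ k < hi K k"
    using middle_face_strict[OF assms] by blast
  then show "Q = K"
    using strict_unique[OF nbD(1)[OF assms], of Q x] Q by blast
qed

lemma face_eq_other:
  assumes "fat_box K" "dir (face K j t) = i" "face K j t \<noteq> face K i s"
  shows "face K j t = face K i (\<not> s)"
  using assms(2,3) by (cases s; cases t) (simp_all add: dir_face[OF assms(1)])

lemma other_face:
  assumes "fat_box K"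
  shows "(THE \<sigma>'. \<sigma>' \<in> box_edges K \<and> dir \<sigma>' = i \<and> \<sigma>' \<noteq> face K i s) = face K i (\<not> s)"
proof (rule the_equality)
  show "face K i (\<not> s) \<in> box_edges K \<and> dir (face K i (\<not> s)) = i \<and> face K i (\<not> s) \<noteq> face K i s"
    using assms by (simp add: dir_face face_inject)
next
  fix \<sigma>' assume \<sigma>': "\<sigma>' \<in> box_edges K \<and> dir \<sigma>' = i \<and> \<sigma>' \<noteq> face K i s"
  then obtain j t where \<sigma>'_eq: "\<sigma>' = face K j t" using box_edgesE by metis
  then show "\<sigma>' = face K i (\<not> s)" using \<sigma>' face_eq_other[OF assms] by metis
qed

subsection \<open>Neighbouring dual cells\<close>

lemma aff_dim_face:
  assumes "fat_box (B :: (real ^ 'd) set)"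
  shows "aff_dim (face B i s) = int CARD('d) - 1"
  unfolding face_eq_cbox[OF assms]
  by (rule aff_dim_flat_cbox[where j = i]) (use fat_boxE(2)[OF assms] in auto)

lemma face_Int_dual_cell:
  assumes D: "fat_box D" and \<sigma>: "\<sigma> \<in> edges M"
    and dim: "aff_dim (face D j t \<inter> dual_cell M \<sigma>) = int CARD('d) - 1"
  obtains p q where "face D j t \<inter> dual_cell M \<sigma> = cbox p q" "p $ j = bound D j t" "q $ j = bound D j t"
    "\<And>k. k \<noteq> j \<Longrightarrow> p $ k < q $ k"
proof -
  obtain a b where ab: "dual_cell M \<sigma> = cbox a b" using dual_cell_is_cbox[OF \<sigma>] .
  obtain p q where pq: "face D j t \<inter> dual_cell M \<sigma> = cbox p q"
    unfolding ab face_eq_cbox[OF D] Int_interval by blast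
  moreover have "cbox p q \<subseteq> {x. x $ j = bound D j t}"
    using pq by (auto simp: face_def)
  ultimately show thesis
    using that flat_cbox_dim_cases[of p q j "bound D j t"] dim card_ge_2 by metis
qed

text \<open>Both faces of \<open>K\<close> orthogonal to direction \<open>i\<close> have half cells
  touching the midplane. A competing dual cell contains an interior point of \<open>K\<close>, so
  its edge is a face of \<open>K\<close> too.\<close>

lemma dual_neighbour_middle:
  assumes nb: "nb K i s L"
  shows "dual_neighbour M (face (dual_box K i L) i (\<not> s)) (face K i s) = face K i (\<not> s)"
    (is "dual_neighbour M ?e _ = _")
proof -
  note KM = nbD(1)[OF nb] and fK = nbD(3)[OF nb] and fD = fat_dual_box[OF nb]
  have "?e \<subseteq> half_cell (face K i (\<not> s)) K"
    unfolding middle_face_eq[OF nb] half_cell_face[OF fK] by auto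
  then have "?e \<inter> dual_cell M (face K i (\<not> s)) = ?e"
    using half_cell_subset_dual_cell[OF KM] by blast
  then have dim: "aff_dim (?e \<inter> dual_cell M (face K i (\<not> s))) = int CARD('d) - 1"
    by (simp add: aff_dim_face[OF fD])
  show ?thesis
    unfolding dual_neighbour_def dir_face[OF fK]
  proof (rule the_equality, intro conjI)
    show "face K i (\<not> s) \<in> edges M" using KM by (rule face_in_edges)
    show "face K i (\<not> s) \<noteq> face K i s" by (simp add: face_inject[OF fK])
  next
    fix \<sigma>' assume \<sigma>': "\<sigma>' \<in> edges M \<and> dir \<sigma>' = i \<and> \<sigma>' \<noteq> face K i s \<and>
        aff_dim (?e \<inter> dual_cell M \<sigma>') = int CARD('d) - 1"
    then obtain p q where pq: "?e \<inter> dual_cell M \<sigma>' = cbox p q"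
      "p $ i = bound (dual_box K i L) i (\<not> s)" "q $ i = bound (dual_box K i L) i (\<not> s)"
      "\<And>k. k \<noteq> i \<Longrightarrow> p $ k < q $ k"
      using face_Int_dual_cell[OF fD] by metis
    have le: "p $ k \<le> q $ k" for k using pq(2,3) pq(4)[of k] by (cases "k = i") auto
    then have "p \<in> cbox p q" "q \<in> cbox p q" by (auto simp: mem_box_cart)
    then have pK: "p \<in> K" "q \<in> K" "p $ i = mid K i" "q $ i = mid K i"
      using pq(1) middle_face_eq[OF nb] by auto
    \<comment> \<open>The centre of the intersection lies strictly inside \<open>K\<close>, as the
      intersection has positive extent along the midplane.\<close>
    define x where "x = (\<chi> k. (p $ k + q $ k) / 2)"
    have "x \<in> cbox p q" using le by (auto simp: x_def mem_box_cart)
    then have "x \<in> dual_cell M \<sigma>'" using pq(1) by blast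
    then obtain Q j t where Q: "Q \<in> M" "\<sigma>' = face Q j t" "x \<in> half_cell \<sigma>' Q"
      by (rule mem_dual_cellE)
    have "lo K k < x $ k \<and> x $ k < hi K k" for k
    proof (cases "k = i")
      case True
      then show ?thesis using pK mid_strict[OF fK, of i] by (simp add: x_def)
    next
      case False
      have "lo K k \<le> p $ k" "q $ k \<le> hi K k" using pK(1,2) by (auto simp: mem_fat_box[OF fK])
      then show ?thesis using pq(4)[OF False] by (simp add: x_def)
    qed
    then have "Q = K"
      using strict_unique[OF KM Q(1)] Q(3) by (auto simp: half_cell_def)
    then show "\<sigma>' = face K i (\<not> s)" using \<sigma>' Q(2) face_eq_other[OF fK] by metis
  qed (use dim in \<open>simp_all add: dir_face[OF fK]\<close>)
qed

text \<open>Closes the square of four cells. \<open>Q\<close> and \<open>R\<close> share a corner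
  point and one bound in direction \<open>j\<close>, so their extents there agree; all other bounds
  are inherited from \<open>K\<close> and \<open>L\<close>.\<close>

lemma nb_corner:
  assumes KL: "nb K i s L" and KQ: "nb K j t Q" and LR: "nb L j t R" and ij: "i \<noteq> j"
  shows "nb Q i s R"
proof -
  note fK = nbD(3)[OF KL]
  define x where "x = (\<chi> k. if k = i then bound K i s else if k = j then bound K j t else lo K k)"
  have xK: "x \<in> K"
    using bound_bounds[OF fK] fat_boxE(2)[OF fK] by (auto simp: mem_fat_box[OF fK] x_def less_imp_le)
  then have "x \<in> face K i s" "x \<in> face K j t" using ij by (auto simp: face_def x_def)
  then have xL: "x \<in> L" and xQ: "x \<in> Q"
    using nb_face[OF KL] nb_face[OF KQ] face_subset by blast+
  have bj: "bound L j t = bound K j t" using nbD(6,7)[OF KL] ij by (auto simp: bound_def)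
  then have "x \<in> face L j t" using xL ij by (auto simp: face_def x_def)
  then have xR: "x \<in> R" using nb_face[OF LR] face_subset by blast
  have "bound Q j (\<not> t) = bound R j (\<not> t)" using nbD(5)[OF KQ] nbD(5)[OF LR] bj by simp
  note j = cells_meet_same_bound[OF nbD(2)[OF KQ] nbD(2)[OF LR] xQ xR this]
  have "lo R k = lo Q k \<and> hi R k = hi Q k" if "k \<noteq> i" for k
    using that j nbD(6,7)[OF KL] nbD(6,7)[OF KQ] nbD(6,7)[OF LR] by (cases "k = j") auto
  moreover have "bound R i (\<not> s) = bound Q i s"
    using nbD(5)[OF KL] nbD(6,7)[OF KQ, of i] nbD(6,7)[OF LR, of i] ij
    by (auto simp: bound_def split: if_splits)
  ultimately show ?thesis using nbD(2)[OF KQ] nbD(2)[OF LR] by (simp add: nb_def)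
qed

text \<open>The point is generic on the part of the dual edge in \<open>K\<close>. Any cell
  \<open>Q\<close> through it is \<open>K\<close> itself or the neighbour across side
  \<open>t\<close>, and the position of \<open>x\<close> relative to the midplane decides which half
  of \<open>Q\<close> is meant.\<close>

lemma tangential_neighbour_cases:
  assumes nb: "nb K i s L" and ji: "j \<noteq> i" and x: "x \<in> face (dual_box K i L) j t" "x \<in> K"
    and strict: "\<And>k. k \<noteq> j \<Longrightarrow> lo (dual_box K i L) k < x $ k \<and> x $ k < hi (dual_box K i L) k"
    and xi: "x $ i \<noteq> bound K i s"
    and \<sigma>': "x \<in> dual_cell M \<sigma>'" "dir \<sigma>' = i" "\<sigma>' \<noteq> face K i s"
  obtains Q where "nb K j t Q" "\<sigma>' = face Q i s"
proof -
  note KM = nbD(1)[OF nb] and fK = nbD(3)[OF nb]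
  have xK: "lo K k \<le> x $ k" "x $ k \<le> hi K k" for k using x(2) by (auto simp: mem_fat_box[OF fK])
  have xj: "x $ j = bound K j t" using x(1) by (simp add: face_def bound_dual_box[OF nb ji])
  have xm: "if s then mid K i < x $ i else x $ i < mid K i"
    using strict[of i] ji nb_mid[OF nb] by (auto simp: lo_hi_dual_box[OF nb] split: if_splits)
  have sK: "lo K k < x $ k \<and> x $ k < hi K k" if "k \<noteq> j" for k
  proof (cases "k = i")
    case True
    then show ?thesis
      using xK[of i] xi xm mid_strict[OF fK, of i] by (auto simp: bound_def split: if_splits)
  next
    case False
    then show ?thesis using strict[OF that] by (simp add: lo_hi_dual_box[OF nb])
  qed
  obtain Q i' s' where Q: "Q \<in> M" "\<sigma>' = face Q i' s'" "x \<in> half_cell \<sigma>' Q"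
    using \<sigma>'(1) by (rule mem_dual_cellE)
  note fQ = cell_fat[OF Q(1)]
  have i': "i' = i" using \<sigma>'(2) Q(2) by (simp add: dir_face[OF fQ])
  have xQ: "x \<in> Q" using Q(3) by (simp add: half_cell_def)
  have eq: "lo Q k = lo K k" "hi Q k = hi K k" if "k \<noteq> j" for k
    using cells_meet_strict[OF KM Q(1) x(2) xQ] sK[OF that] by auto
  have "mid Q i = mid K i" using eq[of i] ji by (simp add: mid_def)
  then have s': "s' = s"
    using Q(3) xm unfolding Q(2) i' half_cell_face[OF fQ] by (auto split: if_splits)
  have "bound Q j (\<not> t) = bound K j t"
  proof (rule cells_meet_cases[OF KM Q(1) x(2) xQ, of j])
    assume *: "lo K j = lo Q j" "hi K j = hi Q j"
    have "Q = K"
    proof (intro fat_box_eqI fQ fK)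
      fix k show "lo Q k = lo K k" "hi Q k = hi K k" using eq[of k] * by (cases "k = j"; simp)+
    qed
    then show ?thesis using \<sigma>'(3) Q(2) i' s' by simp
  qed (use xj fat_boxE(2)[OF fK, of j] in \<open>auto simp: bound_def split: if_splits\<close>)
  then have "nb K j t Q" using KM Q(1) eq by (simp add: nb_def)
  then show thesis using that Q(2) i' s' by blast
qed

text \<open>The dual cell of \<open>face Q i s\<close> may cover only part of the dual edge, but it
  contains the half face on the side of \<open>K\<close>, which already has full dimension.
  Uniqueness is tested at a generic point of the intersection, which may lie in \<open>K\<close> or
  in \<open>L\<close>.\<close>

lemma dual_neighbour_tangential:
  assumes nb: "nb K i s L" and ji: "j \<noteq> i" and KQ: "nb K j t Q"
  shows "dual_neighbour M (face (dual_box K i L) j t) (face K i s) = face Q i s"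
    (is "dual_neighbour M ?e _ = _")
proof -
  note KM = nbD(1)[OF nb] and fK = nbD(3)[OF nb] and fD = fat_dual_box[OF nb]
  note QM = nbD(2)[OF KQ] and fQ = nbD(4)[OF KQ]
  let ?H = "half_cell (face K i s) K"
  have "mid Q i = mid K i" using nbD(6,7)[OF KQ, of i] ji by (simp add: mid_def)
  moreover have "face ?H j t \<subseteq> face Q j (\<not> t)"
    using half_face_subset[OF nb ji, of t] nb_face[OF KQ] by auto
  moreover have "face ?H j t \<subseteq> ?H" by (rule face_subset)
  ultimately have "face ?H j t \<subseteq> half_cell (face Q i s) Q"
    unfolding half_cell_face[OF fQ] half_cell_face[OF fK] using face_subset[of Q j "\<not> t"] by auto
  then have "face ?H j t \<subseteq> ?e \<inter> dual_cell M (face Q i s)"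
    using half_cell_subset_dual_cell[OF QM] half_face_subset[OF nb ji, of t] by blast
  from aff_dim_subset[OF this] aff_dim_subset[of "?e \<inter> dual_cell M (face Q i s)" ?e]
  have dim: "aff_dim (?e \<inter> dual_cell M (face Q i s)) = int CARD('d) - 1"
    by (simp add: aff_dim_face[OF fat_half_cell[OF KM]] aff_dim_face[OF fD])
  show ?thesis
    unfolding dual_neighbour_def dir_face[OF fK]
  proof (rule the_equality, intro conjI)
    show "face Q i s \<in> edges M" using QM by (rule face_in_edges)
    show "face Q i s \<noteq> face K i s"
    proof
      assume "face Q i s = face K i s"
      then show False using shared_face(2)[OF KM QM nb_neq[OF KQ], of i s i s] by simp
    qed
  next
    fix \<sigma>' assume \<sigma>': "\<sigma>' \<in> edges M \<and> dir \<sigma>' = i \<and> \<sigma>' \<noteq> face K i s \<and>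
        aff_dim (?e \<inter> dual_cell M \<sigma>') = int CARD('d) - 1"
    then obtain p q where pq: "?e \<inter> dual_cell M \<sigma>' = cbox p q"
      "p $ j = bound (dual_box K i L) j t" "q $ j = bound (dual_box K i L) j t"
      "\<And>k. k \<noteq> j \<Longrightarrow> p $ k < q $ k"
      using face_Int_dual_cell[OF fD] by metis
    have le: "p $ k \<le> q $ k" for k using pq(2,3) pq(4)[of k] by (cases "k = j") auto
    then have "p \<in> cbox p q" "q \<in> cbox p q" by (auto simp: mem_box_cart)
    then have pD: "p \<in> dual_box K i L" "q \<in> dual_box K i L"
      using pq(1) face_subset by blast+
    \<comment> \<open>The coordinate avoids the plane of the edge itself, so the point lies on one
      definite side.\<close>
    obtain z where z: "p $ i < z" "z < q $ i" "z \<noteq> bound K i s"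
      using pq(4)[of i] ji dense[of "p $ i" "q $ i"] dense[of "p $ i"] by (metis less_trans less_irrefl)
    define x where "x = (\<chi> k. if k = i then z else (p $ k + q $ k) / 2)"
    have "x \<in> cbox p q" using le z by (auto simp: x_def mem_box_cart)
    then have x\<sigma>': "x \<in> dual_cell M \<sigma>'" and xe: "x \<in> ?e" using pq(1) by blast+
    have strict: "lo (dual_box K i L) k < x $ k \<and> x $ k < hi (dual_box K i L) k" if "k \<noteq> j" for k
    proof -
      have "lo (dual_box K i L) k \<le> p $ k" "q $ k \<le> hi (dual_box K i L) k"
        using pD by (auto simp: mem_fat_box[OF fD])
      moreover have "p $ k < x $ k" "x $ k < q $ k" using z pq(4)[OF that] by (auto simp: x_def)
      ultimately show ?thesis by linarith
    qed
    have xi: "x $ i \<noteq> bound K i s" using z by (simp add: x_def)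
    have "x \<in> dual_cell M (face K i s)"
      using xe face_subset dual_cell_eq[OF nb] by blast
    then have "x \<in> K \<or> x \<in> L"
      using cells_of_face[OF nb] by (auto simp: dual_cell_def half_cell_def)
    then show "\<sigma>' = face Q i s"
    proof
      assume "x \<in> K"
      then obtain Q' where "nb K j t Q'" "\<sigma>' = face Q' i s"
        using tangential_neighbour_cases[OF nb ji xe _ strict xi x\<sigma>'] \<sigma>' by blast
      then show ?thesis using nb_unique[OF KQ] by simp
    next
      \<comment> \<open>Seen from \<open>L\<close>, the neighbouring edge is a face of
        \<open>R\<close>; the corner lemma identifies it with the face of \<open>Q\<close>.\<close>
      assume xL: "x \<in> L"
      note sym = dual_box_sym[OF nb]
      have xi': "x $ i \<noteq> bound L i (\<not> s)" using xi nbD(5)[OF nb] by simp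
      have "\<sigma>' \<noteq> face L i (\<not> s)" using \<sigma>' nb_face[OF nb] by simp
      then obtain R where R: "nb L j t R" "\<sigma>' = face R i (\<not> s)"
        using tangential_neighbour_cases[OF nb_sym[OF nb] ji, unfolded sym, OF xe xL strict xi' x\<sigma>'] \<sigma>'
        by blast
      show ?thesis using nb_face[OF nb_corner[OF nb KQ R(1)]] R(2) ji by simp
    qed
  qed (use dim in \<open>simp_all add: dir_face[OF fQ]\<close>)
qed

end

section \<open>Primal and dual fluxes\<close>

locale mac_flow = mac \<Omega> M for \<Omega> :: "(real ^ 'd::finite) set" and M +
  fixes \<gamma> \<eta> \<epsilon> \<delta>t :: real and \<rho> :: "'d cell \<Rightarrow> real" and u :: "'d edge \<Rightarrow> real"
begin

abbreviation "F \<equiv> flux \<Omega> M \<gamma> \<eta> \<epsilon> \<delta>t \<rho> u"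
abbreviation "G \<equiv> dual_flux \<Omega> M \<gamma> \<eta> \<epsilon> \<delta>t \<rho> u"
abbreviation "up \<equiv> upwind \<Omega> M \<gamma> \<eta> \<epsilon> \<delta>t \<rho> u"

lemma outer_normal_face:
  assumes "fat_box K"
  shows "outer_normal (face K i s) K = (if s then axis i 1 else - axis i 1)"
  using fat_boxE(2)[OF assms, of i]
  by (auto simp: outer_normal_def dir_face[OF assms] lo_hi_face[OF assms] bound_def)

lemma normal_comp_face:
  assumes "fat_box K"
  shows "normal_comp w (face K i s) K = (if s then w (face K i s) else - w (face K i s))"
  by (simp add: normal_comp_def outer_normal_face[OF assms] dir_face[OF assms] inner_axis_axis)

lemma normal_comp_nb:
  assumes "nb K i s L"
  shows "normal_comp w (face K i s) L = - normal_comp w (face K i s) K"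
  using normal_comp_face[OF nbD(3)[OF assms], of w i s]
    normal_comp_face[OF nbD(4)[OF assms], of w i "\<not> s"] nb_face[OF assms]
  by (cases s) simp_all

text \<open>Passing to the other cell negates both normal velocities. This exchanges
  \<open>vel_plus\<close> and \<open>vel_minus\<close> up to sign, while the two densities are
  exchanged as well.\<close>

lemma flux_antisym:
  assumes "nb K i s L"
  shows "F (face K i s) L = - F (face K i s) K"
proof -
  have "opposite M (face K i s) L = K"
    using opposite_eq[OF nb_sym[OF assms]] by (simp add: nb_face[OF assms])
  then show ?thesis
    unfolding flux_def vel_plus_def vel_minus_def opposite_eq[OF assms] normal_comp_nb[OF assms]
    by (simp add: pos_part_def neg_part_def algebra_simps diff_divide_distrib add_divide_distrib)
qed

lemma flux_frontier: "\<sigma> \<subseteq> frontier \<Omega> \<Longrightarrow> F \<sigma> K = 0"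
  by (simp add: flux_def int_edges_def)

lemma dual_flux_middle:
  assumes "nb K i s L"
  shows "G (face (dual_box K i L) i (\<not> s)) (face K i s) = (F (face K i (\<not> s)) K - F (face K i s) K) / 2"
  using middle_face_not_frontier[OF assms]
  by (simp add: dual_flux_def dir_face[OF fat_dual_box[OF assms]] dir_face[OF nbD(3)[OF assms]]
      middle_face_cell[OF assms] other_face[OF nbD(3)[OF assms]] Let_def)

lemma dual_flux_tangential:
  assumes nb: "nb K i s L" and ji: "j \<noteq> i"
  shows "G (face (dual_box K i L) j t) (face K i s) = (F (face K j t) K + F (face L j t) L) / 2"
proof (cases "face (dual_box K i L) j t \<subseteq> frontier \<Omega>")
  case True
  have "face K j t \<subseteq> frontier \<Omega>" "face L j t \<subseteq> frontier \<Omega>"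
    using tangential_face_frontier[OF nb ji True]
      tangential_face_frontier[OF nb_sym[OF nb] ji, unfolded dual_box_sym[OF nb], OF True] by auto
  then show ?thesis using True by (simp add: dual_flux_def flux_frontier)
next
  case False
  note K = tangential_face_unique[OF nb ji, of t]
  note L = tangential_face_unique[OF nb_sym[OF nb] ji, unfolded dual_box_sym[OF nb], of t]
  have "opposite M (face K i s) L = K"
    using opposite_eq[OF nb_sym[OF nb]] by (simp add: nb_face[OF nb])
  then show ?thesis
    using False ji opposite_eq[OF nb] cell_before_eq[OF nb]
    by (cases s) (simp_all add: dual_flux_def dir_face[OF fat_dual_box[OF nb]] dir_face[OF nbD(3)[OF nb]]
        K L Let_def)
qed

text \<open>The dual fluxes are averages chosen so that a dual cell inherits the mass balance of its
  two primal cells. The flux through the edge itself is internal to the dual cell and drops out by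
  \<open>flux_antisym\<close>.\<close>

lemma sum_dual_flux:
  assumes nb: "nb K i s L"
  shows "(\<Sum>e\<in>box_edges (dual_box K i L). G e (face K i s))
    = ((\<Sum>\<sigma>\<in>box_edges K. F \<sigma> K) + (\<Sum>\<sigma>\<in>box_edges L. F \<sigma> L)) / 2"
proof -
  let ?D = "dual_box K i L"
  have "G (face ?D k s) (face K i s) + G (face ?D k (\<not> s)) (face K i s)
      = ((F (face K k s) K + F (face K k (\<not> s)) K) + (F (face L k s) L + F (face L k (\<not> s)) L)) / 2"
    (is "?G k = ?F k") for k
  proof (cases "k = i")
    case True
    have "G (face ?D i s) (face K i s) = (F (face L i s) L - F (face L i (\<not> s)) L) / 2"
      using dual_flux_middle[OF nb_sym[OF nb]] by (simp add: dual_box_sym[OF nb] nb_face[OF nb])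
    then show ?thesis
      using True dual_flux_middle[OF nb] flux_antisym[OF nb] nb_face[OF nb] by (simp add: field_simps)
  next
    case False
    then show ?thesis by (simp add: dual_flux_tangential[OF nb False] field_simps)
  qed
  then have "(\<Sum>k\<in>UNIV. ?G k) = (\<Sum>k\<in>UNIV. ?F k)" by (rule sum.cong[OF refl])
  then show ?thesis
    unfolding sum_box_edges[OF fat_dual_box[OF nb], where s = s]
      sum_box_edges[OF nbD(3)[OF nb], where s = s] sum_box_edges[OF nbD(4)[OF nb], where s = s]
      sum_divide_distrib[symmetric] sum.distrib[symmetric] .
qed

text \<open>The return conditions are restricted to internal \<open>\<sigma>'\<close>: for an
  external one \<open>e\<close> need not be an edge of its dual cell, and only the vanishing
  velocity there is used.\<close>

definition reciprocal :: "'d edge \<Rightarrow> 'd edge \<Rightarrow> 'd edge \<Rightarrow> bool" where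
  "reciprocal e \<sigma> \<sigma>' \<longleftrightarrow> dual_neighbour M e \<sigma> = \<sigma>' \<and> \<sigma>' \<in> edges M \<and>
     (\<sigma>' \<in> int_edges \<Omega> M \<longrightarrow>
        e \<in> box_edges (dual_cell M \<sigma>') \<and> G e \<sigma>' = - G e \<sigma> \<and> dual_neighbour M e \<sigma>' = \<sigma>)"

lemma reciprocal_middle:
  assumes nb: "nb K i s L"
  shows "reciprocal (face (dual_box K i L) i (\<not> s)) (face K i s) (face K i (\<not> s))"
  unfolding reciprocal_def
proof (intro conjI impI)
  note KM = nbD(1)[OF nb]
  show "dual_neighbour M (face (dual_box K i L) i (\<not> s)) (face K i s) = face K i (\<not> s)"
    by (rule dual_neighbour_middle[OF nb])
  show "face K i (\<not> s) \<in> edges M" by (rule face_in_edges[OF KM])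
  assume "face K i (\<not> s) \<in> int_edges \<Omega> M"
  then obtain R where R: "nb K i (\<not> s) R"
    using face_int_edges_iff[OF KM] nb_exists[OF KM] by metis
  have e: "face (dual_box K i L) i (\<not> s) = face (dual_box K i R) i (\<not> \<not> s)"
    unfolding middle_face_eq[OF nb] middle_face_eq[OF R] ..
  show "face (dual_box K i L) i (\<not> s) \<in> box_edges (dual_cell M (face K i (\<not> s)))"
    unfolding e dual_cell_eq[OF R] by (rule face_in_box_edges)
  show "G (face (dual_box K i L) i (\<not> s)) (face K i (\<not> s)) = - G (face (dual_box K i L) i (\<not> s)) (face K i s)"
    unfolding dual_flux_middle[OF nb] unfolding e dual_flux_middle[OF R] by (simp add: field_simps)
  show "dual_neighbour M (face (dual_box K i L) i (\<not> s)) (face K i (\<not> s)) = face K i s"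
    unfolding e dual_neighbour_middle[OF R] by simp
qed

text \<open>With \<open>R\<close> completing the square, \<open>e\<close> is a common face of two
  dual boxes. Its flux is the mean over two primal faces seen from \<open>K\<close> and
  \<open>L\<close> or from \<open>Q\<close> and \<open>R\<close>, hence changes sign.\<close>

lemma reciprocal_tangential:
  assumes nb: "nb K i s L" and ji: "j \<noteq> i" and KQ: "nb K j t Q"
  shows "reciprocal (face (dual_box K i L) j t) (face K i s) (face Q i s)"
  unfolding reciprocal_def
proof (intro conjI impI)
  note QM = nbD(2)[OF KQ]
  show "dual_neighbour M (face (dual_box K i L) j t) (face K i s) = face Q i s"
    by (rule dual_neighbour_tangential[OF nb ji KQ])
  show "face Q i s \<in> edges M" by (rule face_in_edges[OF QM])
  assume "face Q i s \<in> int_edges \<Omega> M"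
  then obtain R where R: "nb Q i s R"
    using face_int_edges_iff[OF QM] nb_exists[OF QM] by metis
  have LR: "nb L j t R" using nb_corner[OF KQ nb R ji] .
  note nbds = nbD(6,7)[OF nb] nbD(6,7)[OF KQ] nbD(6,7)[OF LR]
  have m: "mid Q i = mid K i" "mid R i = mid L i" using nbds ji by (simp_all add: mid_def)
  have b: "bound (dual_box Q i R) j (\<not> t) = bound (dual_box K i L) j t"
    using nbD(5)[OF KQ] by (simp add: bound_dual_box[OF nb ji] bound_dual_box[OF R ji])
  have e: "face (dual_box K i L) j t = face (dual_box Q i R) j (\<not> t)"
    unfolding face_eq_cbox[OF fat_dual_box[OF nb]] face_eq_cbox[OF fat_dual_box[OF R]] b
    using nbD(6,7)[OF KQ]
    by (auto intro!: arg_cong2[where f = cbox] simp: vec_eq_iff lo_hi_dual_box[OF nb] lo_hi_dual_box[OF R] m)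
  show "face (dual_box K i L) j t \<in> box_edges (dual_cell M (face Q i s))"
    unfolding e dual_cell_eq[OF R] by (rule face_in_box_edges)
  show "G (face (dual_box K i L) j t) (face Q i s) = - G (face (dual_box K i L) j t) (face K i s)"
    unfolding dual_flux_tangential[OF nb ji] unfolding e dual_flux_tangential[OF R ji]
    using flux_antisym[OF KQ] flux_antisym[OF LR] by (simp add: nb_face[OF KQ] nb_face[OF LR] field_simps)
  show "dual_neighbour M (face (dual_box K i L) j t) (face Q i s) = face K i s"
    unfolding e by (rule dual_neighbour_tangential[OF R ji nb_sym[OF KQ]])
qed

lemma reciprocal_exists:
  assumes nb: "nb K i s L" and e: "e \<in> box_edges (dual_box K i L)" "\<not> e \<subseteq> frontier \<Omega>"
  obtains \<sigma>' where "reciprocal e (face K i s) \<sigma>'"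
proof -
  obtain j t where e_eq: "e = face (dual_box K i L) j t" using e(1) by (rule box_edgesE)
  note sym = nb_sym[OF nb] dual_box_sym[OF nb] nb_face[OF nb]
  consider "j = i" "t = (\<not> s)" | "j = i" "t = s" | "j \<noteq> i" by blast
  then show thesis
  proof cases
    case 1
    then show thesis using that reciprocal_middle[OF nb] e_eq by simp
  next
    case 2
    then show thesis
      using that reciprocal_middle[OF sym(1)] sym(2,3) e_eq by simp
  next
    case 3
    \<comment> \<open>At a re-entrant corner one of these faces may be on the boundary; the other
      still leads to the dual neighbour.\<close>
    have "e \<subseteq> face K j t \<union> face L j t"
    proof
      fix x assume x: "x \<in> e"
      then have "x \<in> dual_cell M (face K i s)" using e_eq face_subset dual_cell_eq[OF nb] by blast
      then have "x \<in> K \<or> x \<in> L"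
        using cells_of_face[OF nb] by (auto simp: dual_cell_def half_cell_def)
      moreover have "x $ j = bound K j t" using x e_eq by (simp add: mem_face bound_dual_box[OF nb 3])
      moreover have "bound L j t = bound K j t" using nbD(6,7)[OF nb 3] by (simp add: bound_def)
      ultimately show "x \<in> face K j t \<union> face L j t" by (auto simp: mem_face)
    qed
    then have "\<not> face K j t \<subseteq> frontier \<Omega> \<or> \<not> face L j t \<subseteq> frontier \<Omega>" using e(2) by blast
    then show thesis
    proof
      assume "\<not> face K j t \<subseteq> frontier \<Omega>"
      then obtain Q where "nb K j t Q" using nb_exists[OF nbD(1)[OF nb]] by blast
      then show thesis using that reciprocal_tangential[OF nb 3] e_eq by blast
    next
      assume "\<not> face L j t \<subseteq> frontier \<Omega>"
      then obtain Q where "nb L j t Q" using nb_exists[OF nbD(2)[OF nb]] by blast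
      from reciprocal_tangential[OF sym(1) 3 this] show thesis
        using that sym(2,3) e_eq by simp
    qed
  qed
qed

lemma sum_upwind_energy_nonneg:
  assumes "u \<in> H0 \<Omega> M"
  shows "0 \<le> (\<Sum>\<sigma>\<in>int_edges \<Omega> M. \<Sum>e\<in>box_edges (dual_cell M \<sigma>). G e \<sigma> * (up e \<sigma>)\<^sup>2)"
proof -
  define S where "S = (SIGMA \<sigma>:int_edges \<Omega> M. box_edges (dual_cell M \<sigma>))"
  define A where "A = {(\<sigma>, e) \<in> S. \<not> e \<subseteq> frontier \<Omega> \<and> dual_neighbour M e \<sigma> \<in> int_edges \<Omega> M}"
  define g where "g = (\<lambda>(\<sigma>, e). G e \<sigma> * (up e \<sigma>)\<^sup>2)"
  define \<phi> where "\<phi> = (\<lambda>(\<sigma>, e). (dual_neighbour M e \<sigma>, e))"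
  have fin: "finite S" using finite_int_edges by (simp add: S_def)
  have A: "A \<subseteq> S" by (auto simp: A_def)
  have rec: "reciprocal e \<sigma> (dual_neighbour M e \<sigma>)" if S: "(\<sigma>, e) \<in> S" and e: "\<not> e \<subseteq> frontier \<Omega>" for \<sigma> e
  proof -
    have "\<sigma> \<in> int_edges \<Omega> M" using S by (simp add: S_def)
    then obtain K L where K: "nb K (dir \<sigma>) True L" "\<sigma> = face K (dir \<sigma>) True"
      by (rule int_edges_nbE)
    then have "e \<in> box_edges (dual_box K (dir \<sigma>) L)"
      using S K(2) dual_cell_eq[OF K(1)] by (simp add: S_def)
    then obtain \<sigma>' where "reciprocal e \<sigma> \<sigma>'"
      using reciprocal_exists[OF K(1) _ e] K(2) by metis
    then show ?thesis by (auto simp: reciprocal_def)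
  qed
  have inv: "\<phi> x \<in> A" "\<phi> (\<phi> x) = x" "g (\<phi> x) = - g x" if "x \<in> A" for x
  proof -
    obtain \<sigma> e where x: "x = (\<sigma>, e)" by (cases x)
    have S: "(\<sigma>, e) \<in> S" and e: "\<not> e \<subseteq> frontier \<Omega>" and N: "dual_neighbour M e \<sigma> \<in> int_edges \<Omega> M"
      using that x by (auto simp: A_def)
    note r = rec[OF S e, unfolded reciprocal_def]
    show "\<phi> x \<in> A" "\<phi> (\<phi> x) = x" using r S e N x by (auto simp: \<phi>_def A_def S_def)
    \<comment> \<open>Both sides select the same upwind value unless the flux is zero, in which case
      both terms vanish.\<close>
    show "g (\<phi> x) = - g x" using r N x by (auto simp: g_def \<phi>_def upwind_def)
  qed
  have "sum g A = sum (\<lambda>x. - g x) A"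
    by (rule sum.reindex_bij_witness[of A \<phi> \<phi>]) (use inv in auto)
  then have A0: "sum g A = 0" by (simp add: sum_negf)
  have "g x \<ge> 0" if "x \<in> S - A" for x
  proof -
    obtain \<sigma> e where x: "x = (\<sigma>, e)" by (cases x)
    show ?thesis
    proof (cases "e \<subseteq> frontier \<Omega>")
      case True
      then show ?thesis by (simp add: g_def x dual_flux_def)
    next
      case False
      then have "dual_neighbour M e \<sigma> \<notin> int_edges \<Omega> M" "dual_neighbour M e \<sigma> \<in> edges M"
        using that x rec[of \<sigma> e] by (auto simp: A_def reciprocal_def)
      then have "u (dual_neighbour M e \<sigma>) = 0"
        using assms by (auto simp: H0_def ext_edges_def int_edges_def)
      \<comment> \<open>An outgoing flux gives a nonnegative term, an incoming one carries the value
        0.\<close>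
      then show ?thesis by (simp add: g_def x upwind_def)
    qed
  qed
  then have "sum g (S - A) \<ge> 0" by (rule sum_nonneg)
  then have "sum g S \<ge> 0" using sum.subset_diff[OF A fin, of g] A0 by simp
  then show ?thesis
    using finite_int_edges by (simp add: S_def g_def sum.Sigma)
qed

text \<open>Discrete integration by parts: exchanging the sums, each internal edge is met from
  exactly its two cells.\<close>

lemma sum_cells_faces:
  assumes "\<And>\<sigma> K. \<sigma> \<subseteq> frontier \<Omega> \<Longrightarrow> f \<sigma> K = 0"
  shows "(\<Sum>K\<in>M. \<Sum>\<sigma>\<in>box_edges K. f \<sigma> K) =
    (\<Sum>\<sigma>\<in>int_edges \<Omega> M. f \<sigma> (cell_before M \<sigma>) + f \<sigma> (opposite M \<sigma> (cell_before M \<sigma>)))"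
proof -
  have "(\<Sum>K\<in>M. \<Sum>\<sigma>\<in>box_edges K. f \<sigma> K) = (\<Sum>K\<in>M. \<Sum>\<sigma>\<in>{\<sigma> \<in> edges M. \<sigma> \<in> box_edges K}. f \<sigma> K)"
    by (intro sum.cong refl) (auto simp: edges_def)
  also have "\<dots> = (\<Sum>\<sigma>\<in>edges M. \<Sum>K\<in>{K \<in> M. \<sigma> \<in> box_edges K}. f \<sigma> K)"
    by (rule sum.swap_restrict[OF finite_cells finite_edges])
  also have "\<dots> = (\<Sum>\<sigma>\<in>int_edges \<Omega> M. \<Sum>K\<in>{K \<in> M. \<sigma> \<in> box_edges K}. f \<sigma> K)"
    by (rule sum.mono_neutral_right[OF finite_edges]) (auto simp: int_edges_def assms)
  also have "\<dots> = (\<Sum>\<sigma>\<in>int_edges \<Omega> M. f \<sigma> (cell_before M \<sigma>) + f \<sigma> (opposite M \<sigma> (cell_before M \<sigma>)))"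
  proof (intro sum.cong refl)
    fix \<sigma> assume "\<sigma> \<in> int_edges \<Omega> M"
    then obtain K L where K: "nb K (dir \<sigma>) True L" "\<sigma> = face K (dir \<sigma>) True"
      by (rule int_edges_nbE)
    then have "{K \<in> M. \<sigma> \<in> box_edges K} = {K, L}" "cell_before M \<sigma> = K" "opposite M \<sigma> K = L"
      using cells_of_face[OF K(1)] cell_before_eq[OF K(1)] opposite_eq[OF K(1)] by simp_all
    then show "(\<Sum>K\<in>{K \<in> M. \<sigma> \<in> box_edges K}. f \<sigma> K)
        = f \<sigma> (cell_before M \<sigma>) + f \<sigma> (opposite M \<sigma> (cell_before M \<sigma>))"
      using nb_neq[OF K(1)] by simp
  qed
  finally show ?thesis .
qed

lemma area_nonneg:
  assumes "fat_box K"
  shows "area (face K i s) \<ge> 0"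
  unfolding area_def using fat_boxE(2)[OF assms]
  by (intro prod_nonneg) (auto simp: lo_hi_face[OF assms] less_imp_le)

lemma vol_dual_cell_pos: "nb K i s L \<Longrightarrow> vol (dual_cell M (face K i s)) > 0"
  using vol_fat_box_pos[of K] vol_fat_box_pos[of L] by (simp add: vol_dual_cell nbD)

lemma partial_deriv_face:
  assumes nb: "nb K i True L" and int: "face K i True \<in> int_edges \<Omega> M"
  shows "vol (dual_cell M (face K i True)) * partial_deriv \<Omega> M i q (face K i True)
    = area (face K i True) * (q L - q K)"
proof -
  have "vol (dual_cell M (face K i True)) > 0" by (rule vol_dual_cell_pos[OF nb])
  then show ?thesis
    using int by (simp add: partial_deriv_def int_edges_dir_def dir_face[OF nbD(3)[OF nb]]
        cell_before_eq[OF nb] opposite_eq[OF nb] outer_normal_face[OF nbD(3)[OF nb]] Let_def inner_axis_axis)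
qed

lemma dual_mean_face:
  assumes nb: "nb K i True L"
  shows "vol (dual_cell M (face K i True)) * dual_mean M q (face K i True)
    = vol K / 2 * q K + vol L / 2 * q L"
proof -
  have "vol (dual_cell M (face K i True)) > 0" by (rule vol_dual_cell_pos[OF nb])
  moreover have "vol (half_cell (face K i True) L) = vol L / 2"
    using vol_half_cell[OF nbD(4)[OF nb], of i False] nb_face[OF nb] by simp
  ultimately show ?thesis
    by (simp add: dual_mean_def cell_before_eq[OF nb] opposite_eq[OF nb] vol_half_cell[OF nbD(3)[OF nb]])
qed

subsection \<open>Energy balances\<close>

lemma mass_balance_cell:
  assumes "\<delta>t > 0" "K \<in> M"
    and "\<forall>K\<in>M. 1 / \<delta>t * (\<rho> K - \<rho>\<^sub>0 K) + 1 / vol K * (\<Sum>\<sigma>\<in>box_edges K. F \<sigma> K) = 0"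
  shows "(\<Sum>\<sigma>\<in>box_edges K. F \<sigma> K) = - (vol K * (\<rho> K - \<rho>\<^sub>0 K) / \<delta>t)"
  using assms(1) assms(3)[rule_format, OF assms(2)] vol_fat_box_pos[OF cell_fat[OF assms(2)]]
  by (simp add: field_simps eq_neg_iff_add_eq_0)

text \<open>Half the sum of the mass balances of the two cells; the weights in
  \<open>dual_mean\<close> are their half volumes.\<close>

lemma dual_mass_balance:
  assumes "\<delta>t > 0"
    and mass: "\<forall>K\<in>M. 1 / \<delta>t * (\<rho> K - \<rho>\<^sub>0 K) + 1 / vol K * (\<Sum>\<sigma>\<in>box_edges K. F \<sigma> K) = 0"
    and \<sigma>: "\<sigma> \<in> int_edges \<Omega> M"
  shows "vol (dual_cell M \<sigma>) * (dual_mean M \<rho> \<sigma> - dual_mean M \<rho>\<^sub>0 \<sigma>) / \<delta>t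
    + (\<Sum>e\<in>box_edges (dual_cell M \<sigma>). G e \<sigma>) = 0"
proof -
  obtain i K L where nb: "nb K i True L" and \<sigma>_eq: "\<sigma> = face K i True"
    using int_edges_nbE[OF \<sigma>] by metis
  have "(\<Sum>e\<in>box_edges (dual_cell M \<sigma>). G e \<sigma>)
      = - ((vol K / 2 * \<rho> K + vol L / 2 * \<rho> L) - (vol K / 2 * \<rho>\<^sub>0 K + vol L / 2 * \<rho>\<^sub>0 L)) / \<delta>t"
    unfolding \<sigma>_eq dual_cell_eq[OF nb] sum_dual_flux[OF nb]
      mass_balance_cell[OF assms(1) nbD(1)[OF nb] mass]
      mass_balance_cell[OF assms(1) nbD(2)[OF nb] mass]
    using assms(1) by (simp add: field_simps)
  then show ?thesis
    unfolding right_diff_distrib \<sigma>_eq dual_mean_face[OF nb] by (simp add: diff_divide_distrib)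
qed

abbreviation "p_grad \<sigma> \<equiv> partial_deriv \<Omega> M (dir \<sigma>) (\<lambda>K. pressure \<gamma> (\<rho> K)) \<sigma>"
abbreviation "vel \<equiv> stab_vel \<Omega> M \<gamma> \<eta> \<epsilon> \<delta>t \<rho> u"

lemma internal_energy_step:
  assumes "\<gamma> \<ge> 1" "\<delta>t > 0" and pos: "\<forall>K\<in>M. \<rho>\<^sub>0 K > 0" "\<forall>K\<in>M. \<rho> K > 0"
    and mass: "\<forall>K\<in>M. 1 / \<delta>t * (\<rho> K - \<rho>\<^sub>0 K) + 1 / vol K * (\<Sum>\<sigma>\<in>box_edges K. F \<sigma> K) = 0"
  shows "(\<Sum>K\<in>M. vol K * Pi_energy \<gamma> (\<rho> K)) - (\<Sum>K\<in>M. vol K * Pi_energy \<gamma> (\<rho>\<^sub>0 K))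
    \<le> \<delta>t * (\<Sum>\<sigma>\<in>int_edges \<Omega> M. vol (dual_cell M \<sigma>) * p_grad \<sigma> * vel \<sigma>)"
proof -
  define a where "a K = psi_deriv \<gamma> (\<rho> K) - psi_deriv \<gamma> 1" for K
  have edge: "- (vol (dual_cell M \<sigma>) * p_grad \<sigma> * vel \<sigma>)
      \<le> a (cell_before M \<sigma>) * F \<sigma> (cell_before M \<sigma>)
        + a (opposite M \<sigma> (cell_before M \<sigma>)) * F \<sigma> (opposite M \<sigma> (cell_before M \<sigma>))"
    if \<sigma>: "\<sigma> \<in> int_edges \<Omega> M" for \<sigma>
  proof -
    obtain i K L where nb: "nb K i True L" and \<sigma>_eq: "\<sigma> = face K i True"
      using int_edges_nbE[OF \<sigma>] by metis
    note KM = nbD(1)[OF nb] and LM = nbD(2)[OF nb] and fK = nbD(3)[OF nb]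
    have cells: "cell_before M \<sigma> = K" "opposite M \<sigma> K = L"
      using cell_before_eq[OF nb] opposite_eq[OF nb] \<sigma>_eq by simp_all
    define vp where "vp = vel_plus \<Omega> M \<gamma> \<eta> \<epsilon> \<delta>t \<rho> u \<sigma> K"
    define vm where "vm = vel_minus \<Omega> M \<gamma> \<eta> \<epsilon> \<delta>t \<rho> u \<sigma> K"
    have v: "vp + vm = vel \<sigma>"
      unfolding vp_def vm_def vel_plus_add_vel_minus[OF \<sigma>] unfolding \<sigma>_eq normal_comp_face[OF fK] by simp
    have "vp \<ge> 0" "vm \<le> 0"
      by (auto simp: vp_def vm_def vel_plus_def vel_minus_def pos_part_def neg_part_def)
    then have "(pressure \<gamma> (\<rho> K) - pressure \<gamma> (\<rho> L)) * (vp + vm)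
        \<le> (\<rho> K * vp + \<rho> L * vm) * (psi_deriv \<gamma> (\<rho> K) - psi_deriv \<gamma> (\<rho> L))"
      using pressure_work_le[OF assms(1), of "\<rho> K" "\<rho> L" vp vm] pos(2) KM LM by blast
    then have work: "area \<sigma> * ((pressure \<gamma> (\<rho> K) - pressure \<gamma> (\<rho> L)) * vel \<sigma>)
        \<le> area \<sigma> * ((\<rho> K * vp + \<rho> L * vm) * (psi_deriv \<gamma> (\<rho> K) - psi_deriv \<gamma> (\<rho> L)))"
      unfolding v by (rule mult_left_mono) (simp add: \<sigma>_eq area_nonneg[OF fK])
    have FK: "F \<sigma> K = area \<sigma> * (\<rho> K * vp + \<rho> L * vm)"
      using \<sigma> by (simp add: flux_def cells vp_def vm_def)
    have FL: "F \<sigma> L = - F \<sigma> K" using flux_antisym[OF nb] \<sigma>_eq by simp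
    have "vol (dual_cell M \<sigma>) * p_grad \<sigma> = area \<sigma> * (pressure \<gamma> (\<rho> L) - pressure \<gamma> (\<rho> K))"
      using partial_deriv_face[OF nb] \<sigma> \<sigma>_eq dir_face[OF fK] by simp
    then have "- (vol (dual_cell M \<sigma>) * p_grad \<sigma> * vel \<sigma>)
        = area \<sigma> * ((pressure \<gamma> (\<rho> K) - pressure \<gamma> (\<rho> L)) * vel \<sigma>)"
      by (simp only:) (simp add: algebra_simps)
    also note work
    also have "area \<sigma> * ((\<rho> K * vp + \<rho> L * vm) * (psi_deriv \<gamma> (\<rho> K) - psi_deriv \<gamma> (\<rho> L)))
        = F \<sigma> K * (psi_deriv \<gamma> (\<rho> K) - psi_deriv \<gamma> (\<rho> L))"
      by (simp add: FK)
    \<comment> \<open>The constant \<open>psi_deriv \<gamma> 1\<close> cancels here because the flux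
      is conservative.\<close>
    also have "\<dots> = a K * F \<sigma> K + a L * F \<sigma> L"
      unfolding FL a_def by (simp add: algebra_simps)
    finally show ?thesis by (simp only: cells)
  qed
  have "(\<Sum>K\<in>M. vol K * Pi_energy \<gamma> (\<rho> K)) - (\<Sum>K\<in>M. vol K * Pi_energy \<gamma> (\<rho>\<^sub>0 K))
      = (\<Sum>K\<in>M. vol K * (Pi_energy \<gamma> (\<rho> K) - Pi_energy \<gamma> (\<rho>\<^sub>0 K)))"
    by (simp add: sum_subtractf right_diff_distrib)
  also have "\<dots> \<le> (\<Sum>K\<in>M. vol K * (a K * (\<rho> K - \<rho>\<^sub>0 K)))"
    unfolding a_def using pos assms(1)
    by (intro sum_mono mult_left_mono Pi_energy_diff_le less_imp_le[OF vol_fat_box_pos] cell_fat) auto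
  also have "\<dots> = (\<Sum>K\<in>M. - \<delta>t * (\<Sum>\<sigma>\<in>box_edges K. a K * F \<sigma> K))"
  proof (intro sum.cong refl)
    fix K assume K: "K \<in> M"
    show "vol K * (a K * (\<rho> K - \<rho>\<^sub>0 K)) = - \<delta>t * (\<Sum>\<sigma>\<in>box_edges K. a K * F \<sigma> K)"
      unfolding sum_distrib_left[symmetric] mass_balance_cell[OF assms(2) K mass]
      using assms(2) by simp
  qed
  also have "\<dots> = - \<delta>t * (\<Sum>K\<in>M. \<Sum>\<sigma>\<in>box_edges K. a K * F \<sigma> K)"
    by (simp add: sum_distrib_left)
  also have "\<dots> = - \<delta>t * (\<Sum>\<sigma>\<in>int_edges \<Omega> M. a (cell_before M \<sigma>) * F \<sigma> (cell_before M \<sigma>)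
        + a (opposite M \<sigma> (cell_before M \<sigma>)) * F \<sigma> (opposite M \<sigma> (cell_before M \<sigma>)))"
    by (subst sum_cells_faces) (simp_all add: flux_frontier)
  \<comment> \<open>The negative factor reverses the order, so the lower bound \<open>edge\<close>
    is the one required.\<close>
  also have "\<dots> \<le> - \<delta>t * (\<Sum>\<sigma>\<in>int_edges \<Omega> M. - (vol (dual_cell M \<sigma>) * p_grad \<sigma> * vel \<sigma>))"
    using assms(2) by (intro mult_left_mono_neg sum_mono edge) auto
  finally show ?thesis by (simp add: sum_negf)
qed

lemma kinetic_energy_step:
  assumes "\<delta>t > 0" "u \<in> H0 \<Omega> M" and pos: "\<forall>K\<in>M. \<rho> K > 0"
    and mass: "\<forall>K\<in>M. 1 / \<delta>t * (\<rho> K - \<rho>\<^sub>0 K) + 1 / vol K * (\<Sum>\<sigma>\<in>box_edges K. F \<sigma> K) = 0"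
    and momentum: "\<forall>i. \<forall>\<sigma>\<in>int_edges_dir \<Omega> M i.
          1 / \<delta>t * (dual_mean M \<rho> \<sigma> * u\<^sub>1 \<sigma> - dual_mean M \<rho>\<^sub>0 \<sigma> * u \<sigma>) +
          1 / vol (dual_cell M \<sigma>) * (\<Sum>e\<in>box_edges (dual_cell M \<sigma>). G e \<sigma> * up e \<sigma>) +
          1 / \<epsilon>\<^sup>2 * partial_deriv \<Omega> M i (\<lambda>K. pressure \<gamma> (\<rho> K)) \<sigma> = 0"
    and eta: "\<forall>i. \<forall>\<sigma>\<in>int_edges_dir \<Omega> M i. \<eta> \<ge> 1 / dual_mean M \<rho> \<sigma>"
    and cfl: "\<forall>i. \<forall>\<sigma>\<in>int_edges_dir \<Omega> M i. \<delta>t / vol (dual_cell M \<sigma>) *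
            (\<Sum>e\<in>box_edges (dual_cell M \<sigma>). - neg_part (G e \<sigma>) / dual_mean M \<rho> \<sigma>) \<le> 1/2"
  shows "(\<Sum>\<sigma>\<in>int_edges \<Omega> M. vol (dual_cell M \<sigma>) * (1/2) * dual_mean M \<rho> \<sigma> * (u\<^sub>1 \<sigma>)\<^sup>2)
      - (\<Sum>\<sigma>\<in>int_edges \<Omega> M. vol (dual_cell M \<sigma>) * (1/2) * dual_mean M \<rho>\<^sub>0 \<sigma> * (u \<sigma>)\<^sup>2)
    \<le> - (1 / \<epsilon>\<^sup>2 * (\<delta>t * (\<Sum>\<sigma>\<in>int_edges \<Omega> M. vol (dual_cell M \<sigma>) * p_grad \<sigma> * vel \<sigma>)))"
proof -
  let ?E = "\<lambda>\<sigma>. box_edges (dual_cell M \<sigma>)"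
  have edge: "vol (dual_cell M \<sigma>) * (1/2) * dual_mean M \<rho> \<sigma> * (u\<^sub>1 \<sigma>)\<^sup>2
      - vol (dual_cell M \<sigma>) * (1/2) * dual_mean M \<rho>\<^sub>0 \<sigma> * (u \<sigma>)\<^sup>2
      + \<delta>t / 2 * (\<Sum>e\<in>?E \<sigma>. G e \<sigma> * (up e \<sigma>)\<^sup>2)
      \<le> - (1 / \<epsilon>\<^sup>2 * (\<delta>t * (vol (dual_cell M \<sigma>) * p_grad \<sigma> * vel \<sigma>)))"
    if \<sigma>: "\<sigma> \<in> int_edges \<Omega> M" for \<sigma>
  proof -
    obtain i K L where nb: "nb K i True L" and \<sigma>_eq: "\<sigma> = face K i True"
      using int_edges_nbE[OF \<sigma>] by metis
    have \<sigma>i: "\<sigma> \<in> int_edges_dir \<Omega> M (dir \<sigma>)" using \<sigma> by (simp add: int_edges_dir_def)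
    have vK: "vol K > 0" "vol L > 0" using vol_fat_box_pos nbD(3,4)[OF nb] by auto
    have D: "vol (dual_cell M \<sigma>) > 0" using vol_dual_cell_pos[OF nb] \<sigma>_eq by simp
    have "vol (dual_cell M \<sigma>) * dual_mean M \<rho> \<sigma> > 0"
      unfolding \<sigma>_eq dual_mean_face[OF nb] using vK pos nbD(1,2)[OF nb] by (intro add_pos_pos mult_pos_pos) auto
    then have r: "dual_mean M \<rho> \<sigma> > 0" using D by (simp add: zero_less_mult_iff)
    \<comment> \<open>The velocity shift is scaled to be the correction
      \<open>\<eta> * \<delta> * P\<close> produced by \<open>kinetic_step\<close>, so both energy
      estimates involve the same work.\<close>
    have v: "vel \<sigma> = u \<sigma> - \<eta> * \<delta>t * (1 / \<epsilon>\<^sup>2 * p_grad \<sigma>)"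
      using \<sigma> by (simp add: stab_vel_def vel_shift_def)
    show ?thesis
      using kinetic_step[OF D r assms(1) dual_mass_balance[OF assms(1) mass \<sigma>]
          momentum[rule_format, OF \<sigma>i, unfolded upwind_def] cfl[rule_format, OF \<sigma>i]
          eta[rule_format, OF \<sigma>i]]
      unfolding v upwind_def by (simp add: mult_ac)
  qed
  have "0 \<le> \<delta>t / 2 * (\<Sum>\<sigma>\<in>int_edges \<Omega> M. \<Sum>e\<in>?E \<sigma>. G e \<sigma> * (up e \<sigma>)\<^sup>2)"
    using sum_upwind_energy_nonneg[OF assms(2)] assms(1) by simp
  moreover have "(\<Sum>\<sigma>\<in>int_edges \<Omega> M. vol (dual_cell M \<sigma>) * (1/2) * dual_mean M \<rho> \<sigma> * (u\<^sub>1 \<sigma>)\<^sup>2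
      - vol (dual_cell M \<sigma>) * (1/2) * dual_mean M \<rho>\<^sub>0 \<sigma> * (u \<sigma>)\<^sup>2
      + \<delta>t / 2 * (\<Sum>e\<in>?E \<sigma>. G e \<sigma> * (up e \<sigma>)\<^sup>2))
      \<le> (\<Sum>\<sigma>\<in>int_edges \<Omega> M. - (1 / \<epsilon>\<^sup>2 * (\<delta>t * (vol (dual_cell M \<sigma>) * p_grad \<sigma> * vel \<sigma>))))"
    by (intro sum_mono edge)
  ultimately show ?thesis
    by (simp only: sum.distrib sum_subtractf sum_negf sum_distrib_left[symmetric])
qed

end

theorem theorem4p5:
  fixes \<Omega> :: "(real ^ 'd) set" and M :: "'d cell set"
    and \<rho>\<^sub>0 \<rho>\<^sub>1 :: "'d cell \<Rightarrow> real" and u\<^sub>0 u\<^sub>1 :: "'d edge \<Rightarrow> real"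
    and \<epsilon> \<gamma> \<eta> \<delta>t :: real
  assumes "0 < \<epsilon>" "\<epsilon> \<le> 1" "\<gamma> \<ge> 1" "\<eta> > 0" "\<delta>t > 0"
    and "mac_grid \<Omega> M"
    and "u\<^sub>0 \<in> H0 \<Omega> M" "u\<^sub>1 \<in> H0 \<Omega> M"
    and "\<forall>K\<in>M. \<rho>\<^sub>0 K > 0" "\<forall>K\<in>M. \<rho>\<^sub>1 K > 0"
    and mass: "\<forall>K\<in>M.
          1 / \<delta>t * (\<rho>\<^sub>1 K - \<rho>\<^sub>0 K) +
          1 / vol K * (\<Sum>\<sigma>\<in>box_edges K. flux \<Omega> M \<gamma> \<eta> \<epsilon> \<delta>t \<rho>\<^sub>1 u\<^sub>0 \<sigma> K) = 0"
    and momentum: "\<forall>i. \<forall>\<sigma>\<in>int_edges_dir \<Omega> M i.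
          1 / \<delta>t * (dual_mean M \<rho>\<^sub>1 \<sigma> * u\<^sub>1 \<sigma> - dual_mean M \<rho>\<^sub>0 \<sigma> * u\<^sub>0 \<sigma>) +
          1 / vol (dual_cell M \<sigma>) *
            (\<Sum>e\<in>box_edges (dual_cell M \<sigma>).
               dual_flux \<Omega> M \<gamma> \<eta> \<epsilon> \<delta>t \<rho>\<^sub>1 u\<^sub>0 e \<sigma> * upwind \<Omega> M \<gamma> \<eta> \<epsilon> \<delta>t \<rho>\<^sub>1 u\<^sub>0 e \<sigma>) +
          1 / \<epsilon>\<^sup>2 * partial_deriv \<Omega> M i (\<lambda>K. pressure \<gamma> (\<rho>\<^sub>1 K)) \<sigma> = 0"
    and eta: "\<forall>i. \<forall>\<sigma>\<in>int_edges_dir \<Omega> M i. \<eta> \<ge> 1 / dual_mean M \<rho>\<^sub>1 \<sigma>"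
    and cfl: "\<forall>i. \<forall>\<sigma>\<in>int_edges_dir \<Omega> M i.
          \<delta>t / vol (dual_cell M \<sigma>) *
            (\<Sum>e\<in>box_edges (dual_cell M \<sigma>).
               - neg_part (dual_flux \<Omega> M \<gamma> \<eta> \<epsilon> \<delta>t \<rho>\<^sub>1 u\<^sub>0 e \<sigma>) / dual_mean M \<rho>\<^sub>1 \<sigma>) \<le> 1/2"
  shows "1 / \<epsilon>\<^sup>2 * (\<Sum>K\<in>M. vol K * Pi_energy \<gamma> (\<rho>\<^sub>1 K)) +
           (\<Sum>\<sigma>\<in>int_edges \<Omega> M.
              vol (dual_cell M \<sigma>) * (1/2) * dual_mean M \<rho>\<^sub>1 \<sigma> * (u\<^sub>1 \<sigma>)\<^sup>2)
         \<le> 1 / \<epsilon>\<^sup>2 * (\<Sum>K\<in>M. vol K * Pi_energy \<gamma> (\<rho>\<^sub>0 K)) +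
           (\<Sum>\<sigma>\<in>int_edges \<Omega> M.
              vol (dual_cell M \<sigma>) * (1/2) * dual_mean M \<rho>\<^sub>0 \<sigma> * (u\<^sub>0 \<sigma>)\<^sup>2)"
proof -
  interpret mac_flow \<Omega> M \<gamma> \<eta> \<epsilon> \<delta>t \<rho>\<^sub>1 u\<^sub>0
    by unfold_locales (rule assms(6))
  have "1 / \<epsilon>\<^sup>2 * ((\<Sum>K\<in>M. vol K * Pi_energy \<gamma> (\<rho>\<^sub>1 K)) - (\<Sum>K\<in>M. vol K * Pi_energy \<gamma> (\<rho>\<^sub>0 K)))
      \<le> 1 / \<epsilon>\<^sup>2 * (\<delta>t * (\<Sum>\<sigma>\<in>int_edges \<Omega> M. vol (dual_cell M \<sigma>) * p_grad \<sigma> * vel \<sigma>))"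
    using internal_energy_step[OF assms(3,5,9,10) mass] by (intro mult_left_mono) simp_all
  then show ?thesis
    using kinetic_energy_step[OF assms(5,7,10) mass momentum eta cfl]
    unfolding right_diff_distrib by linarith
qed

end
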